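(* Let $n\ge 4$ be an even integer and let $u\in C^\infty(\mathbb{R}^n)$ be such that the conformal metric $g=e^{2u}|dx|^2$ on $\mathbb{R}^n$ has finite total Q-curvature, with Q-curvature $Q$. Suppose that the scalar curvature satisfies $R_g\ge 0$ near infinity. If $$\int_{\mathbb{R}^n}Qe^{nu}\,dx<\frac{(n-1)!\,|\mathbb{S}^n|}{2},$$ then the metric $g$ is complete.
   Context: For a smooth function $u$ on $\mathbb{R}^n$ ($n\ge4$ even) and $g=e^{2u}|dx|^2$ (with $|dx|^2$ the Euclidean metric), the Q-curvature $Q$ of $g$ is the function defined by $(-\Delta)^{n/2}u=Qe^{nu}$, where $\Delta$ is the Euclidean Laplacian. The metric has finite total Q-curvature if $Qe^{nu}\in L^1(\mathbb{R}^n)$. The scalar curvature of $g$ is $R_g=2(n-1)e^{-2u}\left(-\Delta u-\frac{n-2}{2}|\nabla u|^2\right)$. "Near infinity" means outside some compact set. $|\mathbb{S}^n|$ is the volume of the standard unit $n$-sphere. *)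

theory Defs
  imports "HOL-Analysis.Analysis"
begin

definition partial :: "'a::euclidean_space \<Rightarrow> ('a \<Rightarrow> real) \<Rightarrow> 'a \<Rightarrow> real" where
  "partial b f x = frechet_derivative f (at x) b"

primrec Ck :: "nat \<Rightarrow> ('a::euclidean_space \<Rightarrow> real) \<Rightarrow> bool" where
  "Ck 0 f \<longleftrightarrow> continuous_on UNIV f"
| "Ck (Suc k) f \<longleftrightarrow> f differentiable_on UNIV \<and> (\<forall>b\<in>Basis. Ck k (partial b f))"

definition smooth :: "('a::euclidean_space \<Rightarrow> real) \<Rightarrow> bool" where
  "smooth f \<longleftrightarrow> (\<forall>k. Ck k f)"

definition grad :: "('a::euclidean_space \<Rightarrow> real) \<Rightarrow> 'a \<Rightarrow> 'a" where
  "grad f x = (\<Sum>b\<in>Basis. partial b f x *\<^sub>R b)"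

definition laplacian :: "('a::euclidean_space \<Rightarrow> real) \<Rightarrow> 'a \<Rightarrow> real" where
  "laplacian f x = (\<Sum>b\<in>Basis. partial b (partial b f) x)"

definition neg_laplacian_pow :: "nat \<Rightarrow> ('a::euclidean_space \<Rightarrow> real) \<Rightarrow> 'a \<Rightarrow> real" where
  "neg_laplacian_pow m = (\<lambda>f x. - laplacian f x) ^^ m"

text \<open>
  Throughout, a function \<open>u\<close> on a Euclidean space stands for the conformal metric
  \<open>g = e\<^sup>2\<^sup>u |dx|\<^sup>2\<close>, and \<open>n\<close> is the dimension of the space.
\<close>

definition is_Q_curvature :: "('a::euclidean_space \<Rightarrow> real) \<Rightarrow> ('a \<Rightarrow> real) \<Rightarrow> bool" where
  "is_Q_curvature u Q \<longleftrightarrow>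
    (\<forall>x. neg_laplacian_pow (DIM('a) div 2) u x = Q x * exp (real DIM('a) * u x))"

definition scalar_curvature :: "('a::euclidean_space \<Rightarrow> real) \<Rightarrow> 'a \<Rightarrow> real" where
  "scalar_curvature u x =
    2 * (real DIM('a) - 1) * exp (- 2 * u x) *
      (- laplacian u x - (real DIM('a) - 2) / 2 * (norm (grad u x))\<^sup>2)"

text \<open>
  The \<open>g\<close>-length of a path is a Lebesgue integral with values in \<open>[0,\<infinity>]\<close>: the derivative of a
  \<^const>\<open>valid_path\<close> may be unbounded near the finitely many exceptional parameters, so a
  path may have infinite length.
\<close>

definition conf_length :: "('a::euclidean_space \<Rightarrow> real) \<Rightarrow> (real \<Rightarrow> 'a) \<Rightarrow> ennreal" where
  "conf_length u \<gamma> =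
    (\<integral>\<^sup>+t\<in>{0..1}. ennreal (exp (u (\<gamma> t)) * norm (vector_derivative \<gamma> (at t))) \<partial>lborel)"

definition conf_dist :: "('a::euclidean_space \<Rightarrow> real) \<Rightarrow> 'a \<Rightarrow> 'a \<Rightarrow> real" where
  "conf_dist u x y =
    enn2real (INF \<gamma>\<in>{\<gamma>. valid_path \<gamma> \<and> pathstart \<gamma> = x \<and> pathfinish \<gamma> = y}. conf_length u \<gamma>)"

definition conf_speed :: "('a::euclidean_space \<Rightarrow> real) \<Rightarrow> (real \<Rightarrow> 'a) \<Rightarrow> real \<Rightarrow> ennreal" where
  "conf_speed u g t = ennreal (exp (u (g t)) * norm (vector_derivative g (at t))) * indicator {0..1} t"

lemma conf_length_speed: "conf_length u g = (\<integral>\<^sup>+t. conf_speed u g t \<partial>lborel)"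
  by (simp add: conf_length_def conf_speed_def)

lemma conf_speed_measurable:
  fixes u :: "'a::euclidean_space \<Rightarrow> real"
  assumes "continuous_on UNIV u" "valid_path g"
  shows "conf_speed u g \<in> borel_measurable borel"
proof -
  obtain S where S: "finite S" "continuous_on {0..1} g" "g C1_differentiable_on ({0..1} - S)"
    using assms(2) by (auto simp: valid_path_def piecewise_C1_differentiable_on_def)
  have c: "continuous_on ({0..1} - S) (\<lambda>t. vector_derivative g (at t))"
    using S(3) by (auto simp: C1_differentiable_on_eq)
  have "continuous_on ({0..1} - S) (\<lambda>t. exp (u (g t)) * norm (vector_derivative g (at t)))"
    by (intro continuous_intros c continuous_on_compose2[OF assms(1)] 
         continuous_on_subset[OF S(2)]) auto
  then have "(\<lambda>t. indicator ({0..1} - S) t *\<^sub>R (exp (u (g t)) * norm (vector_derivative g (at t)))) 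
      \<in> borel_measurable borel"
    using S(1) by (intro borel_measurable_continuous_on_indicator) (auto intro!: sets.Diff intro: borel_closed finite_imp_closed)
  then have m: "(\<lambda>t. ennreal (indicator ({0..1} - S) t *\<^sub>R (exp (u (g t)) * norm (vector_derivative g (at t))))) 
      \<in> borel_measurable borel" (is "?f \<in> _") by simp
  show ?thesis
    by (rule measurable_discrete_difference[OF m, of S])
      (use S(1) in \<open>auto simp: conf_speed_def indicator_def countable_finite\<close>)
qed

lemma nn_integral_finite_cong:
  assumes "finite S" "\<And>t. t \<notin> S \<Longrightarrow> f t = (h t :: ennreal)"
  shows "(\<integral>\<^sup>+t. f t \<partial>lborel) = (\<integral>\<^sup>+(t::real). h t \<partial>lborel)"
proof (rule nn_integral_cong_AE)
  have "AE t in lborel. t \<notin> S"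
    by (rule AE_discrete_difference) (use assms in \<open>auto simp: countable_finite\<close>)
  then show "AE t in lborel. f t = h t" by eventually_elim (use assms in auto)
qed

lemma conf_length_reverse:
  fixes u :: "'a::euclidean_space \<Rightarrow> real"
  assumes "continuous_on UNIV u" "valid_path g"
  shows "conf_length u (reversepath g) = conf_length u g"
proof -
  obtain S where S: "finite S" "\<And>t. t \<in> {0..1} - S \<Longrightarrow> g differentiable (at t)"
    using assms(2) by (auto simp: valid_path_def piecewise_C1_differentiable_on_def C1_differentiable_on_eq)
  have "conf_speed u (reversepath g) t = conf_speed u g (1 - t)" if "t \<notin> (\<lambda>s. 1 - s) ` S" for t
  proof (cases "t \<in> {0..1}")
    case True
    then have "1 - t \<in> {0..1} - S" using that by (force simp: image_iff)
    then have d: "(g has_vector_derivative vector_derivative g (at (1 - t))) (at (1 - t))"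
      using S(2) vector_derivative_works by blast
    have "((g \<circ> (\<lambda>t. 1 - t)) has_vector_derivative (-1) *\<^sub>R vector_derivative g (at (1 - t))) (at t)"
      by (rule vector_diff_chain_at[rotated], rule d) (auto intro!: derivative_eq_intros)
    then have "vector_derivative (reversepath g) (at t) = - vector_derivative g (at (1 - t))"
      by (simp add: reversepath_def o_def vector_derivative_at)
    then show ?thesis using True by (simp add: conf_speed_def reversepath_def indicator_def)
  qed (auto simp: conf_speed_def indicator_def)
  then have "conf_length u (reversepath g) = (\<integral>\<^sup>+t. conf_speed u g (1 - t) \<partial>lborel)"
    unfolding conf_length_speed by (intro nn_integral_finite_cong[of "(\<lambda>s. 1 - s) ` S"]) (use S in auto)
  also have "\<dots> = conf_length u g"
    using nn_integral_real_affine[OF conf_speed_measurable[OF assms], of "-1" 1]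
    by (simp add: conf_length_speed)
  finally show ?thesis .
qed

lemma conf_length_join:
  fixes u :: "'a::euclidean_space \<Rightarrow> real"
  assumes "continuous_on UNIV u" "valid_path g" "valid_path h"
  shows "conf_length u (g +++ h) = conf_length u g + conf_length u h"
proof -
  obtain S where S: "finite S" "\<And>t. t \<in> {0..1} - S \<Longrightarrow> g differentiable (at t)"
    using assms(2) by (auto simp: valid_path_def piecewise_C1_differentiable_on_def C1_differentiable_on_eq)
  obtain T where T: "finite T" "\<And>t. t \<in> {0..1} - T \<Longrightarrow> h differentiable (at t)"
    using assms(3) by (auto simp: valid_path_def piecewise_C1_differentiable_on_def C1_differentiable_on_eq)
  define X where "X = {1/2} \<union> (\<lambda>s. s / 2) ` S \<union> (\<lambda>s. (s + 1) / 2) ` T"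
  have "conf_speed u (g +++ h) t = 2 * conf_speed u g (0 + 2 * t) + 2 * conf_speed u h (-1 + 2 * t)" if "t \<notin> X" for t
  proof -
    have tS: "2 * t \<notin> S" "2 * t - 1 \<notin> T" "t \<noteq> 1/2"
      using that by (auto simp: X_def image_iff field_simps)
    consider "t \<notin> {0..1}" | "t \<in> {0..<1/2}" | "t \<in> {1/2<..1}" using tS(3) by fastforce
    then show ?thesis
    proof cases
      case 1
      then show ?thesis by (auto simp: conf_speed_def indicator_def)
    next
      case 2
      then have d: "(g has_vector_derivative vector_derivative g (at (2 * t))) (at (2 * t))"
        using S(2) tS vector_derivative_works by (metis Diff_iff atLeastAtMost_iff atLeastLessThan_iff
            field_sum_of_halves less_eq_real_def mult_2 add_mono zero_le_mult_iff zero_le_numeral)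
      have "((g \<circ> (\<lambda>t. 2 * t)) has_vector_derivative 2 *\<^sub>R vector_derivative g (at (2 * t))) (at t)"
        by (rule vector_diff_chain_at[rotated], rule d) (auto intro!: derivative_eq_intros)
      then have "((g +++ h) has_vector_derivative 2 *\<^sub>R vector_derivative g (at (2 * t))) (at t)"
        by (rule has_vector_derivative_transform_within_open[of _ _ _ "{..<1/2}"])
           (use 2 in \<open>auto simp: joinpaths_def\<close>)
      then have "vector_derivative (g +++ h) (at t) = 2 *\<^sub>R vector_derivative g (at (2 * t))"
        by (rule vector_derivative_at)
      then show ?thesis using 2 
        by (auto simp: conf_speed_def joinpaths_def indicator_def ennreal_mult' ac_simps simp flip: ennreal_numeral)
    next
      case 3
      then have d: "(h has_vector_derivative vector_derivative h (at (2 * t - 1))) (at (2 * t - 1))"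
        using T(2)[of "2 * t - 1"] tS vector_derivative_works by auto
      have "((h \<circ> (\<lambda>t. 2 * t - 1)) has_vector_derivative 2 *\<^sub>R vector_derivative h (at (2 * t - 1))) (at t)"
        by (rule vector_diff_chain_at[rotated], rule d) (auto intro!: derivative_eq_intros)
      then have "((g +++ h) has_vector_derivative 2 *\<^sub>R vector_derivative h (at (2 * t - 1))) (at t)"
        by (rule has_vector_derivative_transform_within_open[of _ _ _ "{1/2<..}"])
           (use 3 in \<open>auto simp: joinpaths_def\<close>)
      then have "vector_derivative (g +++ h) (at t) = 2 *\<^sub>R vector_derivative h (at (2 * t - 1))"
        by (rule vector_derivative_at)
      then show ?thesis using 3
        by (auto simp: conf_speed_def joinpaths_def indicator_def ennreal_mult' ac_simps simp flip: ennreal_numeral)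
    qed
  qed
  then have "conf_length u (g +++ h) = (\<integral>\<^sup>+t. 2 * conf_speed u g (0 + 2 * t) + 2 * conf_speed u h (-1 + 2 * t) \<partial>lborel)"
    unfolding conf_length_speed by (intro nn_integral_finite_cong[of X]) (use S T in \<open>auto simp: X_def\<close>)
  also have "\<dots> = 2 * (\<integral>\<^sup>+t. conf_speed u g (0 + 2 * t) \<partial>lborel) + 2 * (\<integral>\<^sup>+t. conf_speed u h (-1 + 2 * t) \<partial>lborel)"
  proof -
    have [measurable]: "conf_speed u g \<in> borel_measurable borel" "conf_speed u h \<in> borel_measurable borel"
      using assms conf_speed_measurable by blast+
    show ?thesis by (subst nn_integral_add) (auto simp: nn_integral_cmult)
  qed
  also have "\<dots> = conf_length u g + conf_length u h"
    using nn_integral_real_affine[OF conf_speed_measurable[OF assms(1,2)], of 2 0]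
      nn_integral_real_affine[OF conf_speed_measurable[OF assms(1,3)], of 2 "-1"]
    by (simp add: conf_length_speed)
  finally show ?thesis .
qed

lemma conf_length_linepath:
  fixes u :: "'a::euclidean_space \<Rightarrow> real"
  assumes "continuous_on UNIV u"
  shows "conf_length u (linepath x y) < \<infinity>"
proof -
  have c: "continuous_on {0..1} (\<lambda>t. exp (u (linepath x y t)) * norm (y - x))"
    by (intro continuous_intros continuous_on_compose2[OF assms]) auto
  obtain s where B: "\<And>t. t \<in> {0..1} \<Longrightarrow>
      exp (u (linepath x y t)) * norm (y - x) \<le> exp (u (linepath x y s)) * norm (y - x)"
    using continuous_attains_sup[OF compact_Icc _ c] by fastforce
  have "conf_length u (linepath x y) \<le> (\<integral>\<^sup>+t\<in>{0..1}. ennreal (exp (u (linepath x y s)) * norm (y - x)) \<partial>(lborel::real measure))"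
    unfolding conf_length_def
    by (intro nn_integral_mono) (use B in \<open>auto simp: indicator_def intro!: ennreal_leI\<close>)
  also have "\<dots> < \<infinity>" by (simp add: nn_integral_cmult_indicator)
  finally show ?thesis .
qed

lemma conf_length_lower:
  fixes u :: "'a::euclidean_space \<Rightarrow> real"
  assumes u: "continuous_on UNIV u" and g: "valid_path g" "pathstart g = x" "pathfinish g = y"
    and m: "\<And>z. z \<in> cball x r \<Longrightarrow> m \<le> u z" and r: "0 < r" "r \<le> dist x y"
  shows "ennreal (exp m * r) \<le> conf_length u g"
proof (cases "conf_length u g = \<infinity>")
  case fin: False
  obtain S where S: "finite S" "continuous_on {0..1} g" "\<And>t. t \<in> {0..1} - S \<Longrightarrow> g differentiable (at t)"
    using g(1) by (auto simp: valid_path_def piecewise_C1_differentiable_on_def C1_differentiable_on_eq)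
  have cd: "continuous_on {0..1} (\<lambda>t. dist x (g t))" by (intro continuous_intros S)
  define K where "K = {t \<in> {0..1}. r \<le> dist x (g t)}"
  have "closed K" unfolding K_def
    by (rule continuous_on_closed_Collect_le) (auto intro!: continuous_intros S)
  then have "compact K" 
    using bounded_subset[OF bounded_closed_interval[of 0 1], of K] by (simp add: compact_eq_bounded_closed K_def Collect_subset subset_iff)
  moreover have "1 \<in> K" using g r by (auto simp: K_def pathfinish_def)
  ultimately obtain s where s: "s \<in> K" "\<And>t. t \<in> K \<Longrightarrow> s \<le> t"
    using compact_attains_inf by (metis empty_iff)
  have s01: "0 \<le> s" "s \<le> 1" "r \<le> dist x (g s)" using s(1) by (auto simp: K_def)
  have ball: "g t \<in> cball x r" if "t \<in> {0..<s}" for t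
  proof (rule ccontr)
    assume "g t \<notin> cball x r"
    then have "t \<in> K" using that s01 by (auto simp: K_def)
    then show False using s(2) that by fastforce
  qed
  let ?D = "\<lambda>t. vector_derivative g (at t)"
  have hi: "(?D has_integral (g s - g 0)) {0..s}"
  proof (rule fundamental_theorem_of_calculus_strong[OF S(1)])
    show "continuous_on {0..s} g" by (rule continuous_on_subset[OF S(2)]) (use s01 in auto)
    show "(g has_vector_derivative ?D t) (at t)" if "t \<in> {0..s} - S" for t
      using S(3)[of t] that s01 by (auto simp: vector_derivative_works)
  qed (use s01 in auto)
  let ?F = "\<lambda>t. indicator {0..<s} t *\<^sub>R ?D t"
  have meas: "?F \<in> borel_measurable borel"
  proof -
    obtain S' where S': "finite S'" "continuous_on ({0..1} - S') ?D"
      using g(1) by (auto simp: valid_path_def piecewise_C1_differentiable_on_def C1_differentiable_on_eq)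
    have "continuous_on ({0..<s} - S') ?D"
      by (rule continuous_on_subset[OF S'(2)]) (use s01 in auto)
    then have "(\<lambda>t. indicator ({0..<s} - S') t *\<^sub>R ?D t) \<in> borel_measurable borel"
      using S' by (intro borel_measurable_continuous_on_indicator) (auto intro!: sets.Diff intro: borel_closed finite_imp_closed)
    then have m: "(\<lambda>t. indicator ({0..<s} - S') t *\<^sub>R ?D t) \<in> borel_measurable borel" .
    show ?thesis
      by (rule measurable_discrete_difference[OF m, of S'])
        (use S' in \<open>auto simp: indicator_def countable_finite\<close>)
  qed
  have le: "ennreal (exp m) * ennreal (norm (?F t)) \<le> conf_speed u g t" for t
    using m[OF ball, of t] s01
    by (auto simp: conf_speed_def indicator_def simp flip: ennreal_mult' intro!: ennreal_leI mult_right_mono)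
  have "ennreal (exp m) * (\<integral>\<^sup>+t. ennreal (norm (?F t)) \<partial>lborel) = (\<integral>\<^sup>+t. ennreal (exp m) * ennreal (norm (?F t)) \<partial>lborel)"
    using measurable_compose[OF meas borel_measurable_norm] by (intro nn_integral_cmult[symmetric]) simp
  also have "\<dots> \<le> conf_length u g"
    unfolding conf_length_speed by (intro nn_integral_mono le)
  finally have L: "ennreal (exp m) * (\<integral>\<^sup>+t. ennreal (norm (?F t)) \<partial>lborel) \<le> conf_length u g" .
  have int: "integrable lborel ?F"
  proof (rule integrableI_bounded)
    show "(\<integral>\<^sup>+t. ennreal (norm (?F t)) \<partial>lborel) < \<infinity>"
    proof (rule ccontr)
      assume "\<not> ?thesis"
      then have "(\<integral>\<^sup>+t. ennreal (norm (?F t)) \<partial>lborel) = top"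
        unfolding infinity_ennreal_def using less_top by blast
      with L have "top \<le> conf_length u g" by (simp only: ennreal_mult_top) simp
      with fin show False by (simp add: top_unique)
    qed
  qed (use meas in simp)
  have "(?F has_integral (LINT t|lborel. ?F t)) UNIV"
    using has_integral_integral_lborel[OF int] .
  then have "((\<lambda>t. if t \<in> {0..<s} then ?D t else 0) has_integral (LINT t|lborel. ?F t)) UNIV"
    by (rule has_integral_eq[rotated]) (auto simp: indicator_def)
  then have "(?D has_integral (LINT t|lborel. ?F t)) {0..<s}"
    by (simp only: has_integral_restrict_UNIV)
  then have "(?D has_integral (LINT t|lborel. ?F t)) {0..s}"
    by (rule has_integral_spike_set_eq[THEN iffD1, rotated 2]) (auto intro: negligible_subset[of "{s}"])
  then have "(LINT t|lborel. ?F t) = g s - g 0"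
    using hi has_integral_unique by blast
  then have "ennreal r \<le> ennreal (norm (LINT t|lborel. ?F t))"
    using s01 g by (auto simp: dist_norm norm_minus_commute pathstart_def intro!: ennreal_leI)
  also have "\<dots> \<le> (\<integral>\<^sup>+t. ennreal (norm (?F t)) \<partial>lborel)"
    by (rule integral_norm_bound_ennreal[OF int])
  finally have "ennreal (exp m) * ennreal r \<le> ennreal (exp m) * (\<integral>\<^sup>+t. ennreal (norm (?F t)) \<partial>lborel)"
    by (rule mult_left_mono) simp
  then show ?thesis using L r by (simp add: ennreal_mult')
qed auto

lemma Metric_space_conf_dist:
  fixes u :: "'a::euclidean_space \<Rightarrow> real"
  assumes u: "continuous_on UNIV u"
  shows "Metric_space UNIV (conf_dist u)"
proof -
  let ?P = "\<lambda>x y. {g. valid_path g \<and> pathstart g = x \<and> pathfinish g = y}"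
  define I where "I x y = (INF g\<in>?P x y. conf_length u g)" for x y
  have fin: "I x y < top" for x y
  proof -
    have "I x y \<le> conf_length u (linepath x y)" unfolding I_def by (rule INF_lower) auto
    then show ?thesis using conf_length_linepath[OF u, of x y] by (simp add: order_le_less_trans)
  qed
  have d: "conf_dist u x y = enn2real (I x y)" for x y
    by (simp add: conf_dist_def I_def)
  have sym1: "I x y \<le> I y x" for x y
    unfolding I_def
  proof (rule INF_greatest)
    fix g assume g: "g \<in> ?P y x"
    then show "(INF g\<in>?P x y. conf_length u g) \<le> conf_length u g"
      using conf_length_reverse[OF u, of g] by (intro INF_lower2[of "reversepath g"]) auto
  qed
  have refl: "I x x = 0" for x
  proof -
    have "I x x \<le> conf_length u (linepath x x)" unfolding I_def by (rule INF_lower) auto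
    also have "\<dots> = 0" by (simp add: conf_length_def)
    finally show ?thesis by simp
  qed
  have pos: "I x y > 0" if "x \<noteq> y" for x y
  proof -
    have "continuous_on (cball x (dist x y)) u" using u by (rule continuous_on_subset) auto
    then obtain z where z: "\<And>w. w \<in> cball x (dist x y) \<Longrightarrow> u z \<le> u w"
      using continuous_attains_inf[of "cball x (dist x y)" u] by (metis cball_eq_empty compact_cball not_less zero_le_dist)
    have "ennreal (exp (u z) * dist x y) \<le> I x y"
      unfolding I_def
      by (rule INF_greatest) (use that z in \<open>auto intro!: conf_length_lower[OF u]\<close>)
    moreover have "0 < ennreal (exp (u z) * dist x y)" using that by simp
    ultimately show ?thesis by (rule less_le_trans[rotated])
  qed
  have tri: "I x z \<le> I x y + I y z" for x y z
  proof (rule ennreal_le_epsilon)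
    fix e :: real assume e: "0 < e"
    have ex: "\<exists>g\<in>?P a b. conf_length u g < I a b + ennreal (e/2)" for a b
    proof -
      have "I a b < I a b + ennreal (e/2)" using fin[of a b] e by (cases "I a b") auto
      then show ?thesis unfolding I_def INF_less_iff by auto
    qed
    obtain g h where g: "g \<in> ?P x y" "conf_length u g < I x y + ennreal (e/2)"
      and h: "h \<in> ?P y z" "conf_length u h < I y z + ennreal (e/2)"
      using ex by meson
    have "I x z \<le> conf_length u (g +++ h)"
      unfolding I_def by (rule INF_lower) (use g h in \<open>auto intro: valid_path_join\<close>)
    also have "\<dots> = conf_length u g + conf_length u h"
      using g h conf_length_join[OF u] by auto
    also have "\<dots> \<le> (I x y + ennreal (e/2)) + (I y z + ennreal (e/2))"
      using g h by (intro add_mono) auto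
    also have "\<dots> = I x y + I y z + (ennreal (e/2) + ennreal (e/2))" by (simp add: add_ac)
    also have "ennreal (e/2) + ennreal (e/2) = ennreal e" using e by (simp flip: ennreal_plus)
    finally show "I x z \<le> I x y + I y z + ennreal e" .
  qed
  show ?thesis
  proof
    show "0 \<le> conf_dist u x y" for x y by (simp add: d)
    show "conf_dist u x y = conf_dist u y x" for x y
      using sym1[of x y] sym1[of y x] by (simp add: d)
    show "conf_dist u x y = 0 \<longleftrightarrow> x = y" for x y
      using refl[of x] pos[of x y] fin[of x y] by (cases "x = y") (auto simp: d enn2real_eq_0_iff)
    show "conf_dist u x z \<le> conf_dist u x y + conf_dist u y z" for x y z
    proof -
      have "enn2real (I x z) \<le> enn2real (I x y + I y z)"
        by (rule enn2real_mono[OF tri]) (use fin in auto)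
      also have "\<dots> = enn2real (I x y) + enn2real (I y z)"
        by (rule enn2real_plus) (use fin in auto)
      finally show ?thesis by (simp add: d)
    qed
  qed
qed

definition complete_conf_metric :: "('a::euclidean_space \<Rightarrow> real) \<Rightarrow> bool" where
  "complete_conf_metric u \<longleftrightarrow> Metric_space.mcomplete UNIV (conf_dist u)"

text \<open>
  The volume of the unit sphere of dimension \<open>n\<close>, that is, of the boundary of the unit ball of
  dimension \<open>n + 1\<close>: the derivative at \<open>r = 1\<close> of the volume \<open>\<omega> r\<^bsup>n+1\<^esup>\<close> of the ball of radius \<open>r\<close>.
\<close>

definition unit_sphere_vol :: "nat \<Rightarrow> real" where
  "unit_sphere_vol n = real (n + 1) * unit_ball_vol (real (n + 1))"

lemma unit_sphere_vol_eq:
  "unit_sphere_vol n = 2 * pi powr ((real n + 1) / 2) / Gamma ((real n + 1) / 2)"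
proof -
  define a where "a = (real n + 1) / 2"
  have a: "a > 0" by (simp add: a_def)
  then have "Gamma (a + 1) = a * Gamma a" "Gamma a > 0"
    by (auto intro: Gamma_plus1 Gamma_real_pos elim!: nonpos_Ints_cases)
  moreover have "real (n + 1) = 2 * a" "real (n + 1) / 2 = a"
    by (simp_all add: a_def)
  then have "unit_sphere_vol n = 2 * a * (pi powr a / Gamma (a + 1))"
    by (simp only: unit_sphere_vol_def unit_ball_vol_def)
  ultimately have "unit_sphere_vol n = 2 * pi powr a / Gamma a"
    using a by simp
  then show ?thesis by (simp add: a_def)
qed

lemma has_real_derivative_content_ball:
  assumes "DIM('a::euclidean_space) = n + 1"
  shows "((\<lambda>r. measure lborel (ball (0::'a) r)) has_real_derivative unit_sphere_vol n) (at 1)"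
proof -
  have "((\<lambda>r. unit_ball_vol (real (n + 1)) * r ^ (n + 1)) has_real_derivative unit_sphere_vol n) (at 1)"
    unfolding unit_sphere_vol_def by (auto intro!: derivative_eq_intros)
  then show ?thesis
    by (rule has_field_derivative_transform_within_open[of _ _ _ "{0<..}"])
      (auto simp: content_ball assms)
qed

end

theory Submission
  imports Defs
begin

text \<open>
  Let \<open>n = 2m\<close> and \<open>p = m - 1 = (n - 2) / 2\<close>. The function \<open>w = e\<^bsup>pu\<^esup>\<close> is positive, and it is superharmonic
  wherever \<open>R\<^sub>g \<ge> 0\<close>. Comparison with \<open>(|x|\<^sup>2 - 1)\<^bsup>-p\<^esup>\<close> gives \<open>w \<ge> c |x|\<^bsup>2-n\<^esup>\<close>, that is
  \<open>u \<ge> - 2 ln |x| - C\<close>, near infinity. Adding a multiple of \<open>(1 + |x|\<^sup>2)\<^bsup>-p\<^esup>\<close>, which \<open>w\<close> dominates, makes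
  \<open>w\<close> superharmonic everywhere, so that the mean value inequality and Jensen's inequality bound \<open>u(x)\<close>
  from below by the weighted mean of \<open>u\<close> over the ball of radius \<open>|x|\<close> about the origin, up to a constant.

  No representation of \<open>u\<close> by a logarithmic potential is needed. With the weights
  \<open>\<psi>\<^sub>k(y) = (1 - |y|\<^sup>2)\<^sub>+\<^sup>k\<close> the means \<open>M\<^sub>k f (r) = \<integral> f(ry) \<psi>\<^sub>k(y) dy\<close> satisfy
  \<open>(M\<^sub>k f)' = r / (2(k+1)) M\<^bsub>k+1\<^esub>(\<Delta>f)\<close>, so in the variable \<open>s = r\<^sup>2\<close> the \<open>m\<close>-th derivative of \<open>M\<^sub>1 u\<close> is
  asymptotic to a constant times \<open>s\<^bsup>-m\<^esup> \<integral> Q e\<^bsup>nu\<^esup>\<close>. Since \<open>u \<ge> - 2 ln |x| - C\<close> excludes polynomial decay,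
  this gives \<open>M\<^sub>1 u \<ge> - B ln s - C\<close>, and the bound on the total Q-curvature allows \<open>2B < \<integral> \<psi>\<^sub>1\<close>. Hence
  \<open>u \<ge> - b ln |x| - C\<close> with \<open>b < 1\<close>, so \<open>g\<close>-bounded sets are bounded and the metric is complete.
\<close>

subsection \<open>Calculus of partial derivatives\<close>

lemma partial_eqI: "(f has_derivative D) (at x) \<Longrightarrow> partial b f x = D b"
  unfolding partial_def by (metis frechet_derivative_at)

lemma Ck_Suc_differentiable: "Ck (Suc k) f \<Longrightarrow> f differentiable (at x)"
  by (auto simp: differentiable_on_def)

lemma Ck_mono_Suc: "Ck (Suc k) f \<Longrightarrow> Ck k f"
  by (induction k arbitrary: f) (auto intro: differentiable_imp_continuous_on)

lemma Ck_mono: "Ck k f \<Longrightarrow> j \<le> k \<Longrightarrow> Ck j f"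
  by (induction k) (use Ck_mono_Suc in \<open>auto simp: le_Suc_eq simp del: Ck.simps\<close>)

lemma Ck_imp_continuous_on: "Ck k f \<Longrightarrow> continuous_on S f"
  using Ck_mono[of k f 0] by (auto intro: continuous_on_subset)

lemma Ck_const [simp]: "Ck k (\<lambda>x. c)"
proof (induction k arbitrary: c)
  case (Suc k)
  have "partial b (\<lambda>x. c) = (\<lambda>x. 0)" for b :: 'a
    by (rule ext, rule partial_eqI) simp
  then show ?case using Suc by simp
qed simp

lemma partial_add:
  assumes "f differentiable (at x)" "g differentiable (at x)"
  shows "partial b (\<lambda>x. f x + g x) x = partial b f x + partial b g x"
  unfolding partial_def
  using has_derivative_add[OF assms[unfolded frechet_derivative_works]]
  by (simp flip: frechet_derivative_at)

lemma partial_mult: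
  assumes "f differentiable (at x)" "g differentiable (at x)"
  shows "partial b (\<lambda>x. f x * g x) x = f x * partial b g x + partial b f x * g x"
  unfolding partial_def
  using has_derivative_mult[OF assms[unfolded frechet_derivative_works]]
  by (simp flip: frechet_derivative_at)

lemma partial_compose:
  assumes "f differentiable (at x)" "(h has_real_derivative D) (at (f x))"
  shows "partial b (\<lambda>x. h (f x)) x = D * partial b f x"
proof -
  have "((\<lambda>x. h (f x)) has_derivative (\<lambda>t. D * frechet_derivative f (at x) t)) (at x)"
    using has_derivative_compose[OF assms(1)[unfolded frechet_derivative_works], of h "(*) D"] assms(2)
    by (simp add: has_field_derivative_def)
  then show ?thesis by (simp add: partial_def flip: frechet_derivative_at)
qed

lemma Ck_add: "Ck k f \<Longrightarrow> Ck k g \<Longrightarrow> Ck k (\<lambda>x. f x + g x)"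
proof (induction k arbitrary: f g)
  case (Suc k)
  then have "partial b (\<lambda>x. f x + g x) = (\<lambda>x. partial b f x + partial b g x)" for b
    by (intro ext partial_add) (auto simp: differentiable_on_def)
  then show ?case using Suc by (auto intro: differentiable_on_add)
qed (auto intro: continuous_intros)

lemma Ck_mult: "Ck k f \<Longrightarrow> Ck k g \<Longrightarrow> Ck k (\<lambda>x. f x * g x)"
proof (induction k arbitrary: f g)
  case (Suc k)
  then have "partial b (\<lambda>x. f x * g x) = (\<lambda>x. f x * partial b g x + partial b f x * g x)" for b
    by (intro ext partial_mult) (auto simp: differentiable_on_def)
  moreover have "Ck k f" "Ck k g" using Suc.prems Ck_mono_Suc by blast+
  ultimately show ?case using Suc by (auto intro!: differentiable_on_mult Ck_add)
qed (auto intro: continuous_intros)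

lemma Ck_sum: "(\<And>i. i \<in> I \<Longrightarrow> Ck k (f i)) \<Longrightarrow> Ck k (\<lambda>x. \<Sum>i\<in>I. f i x)"
  by (induction I rule: infinite_finite_induct) (auto intro: Ck_add)

lemma Ck_power: "Ck k f \<Longrightarrow> Ck k (\<lambda>x. f x ^ j)"
  by (induction j) (auto intro: Ck_mult)

lemma Ck_exp: "Ck k f \<Longrightarrow> Ck k (\<lambda>x. exp (f x))"
proof (induction k arbitrary: f)
  case (Suc k)
  then have "partial b (\<lambda>x. exp (f x)) = (\<lambda>x. exp (f x) * partial b f x)" for b
    by (intro ext partial_compose) (auto simp: differentiable_on_def intro!: DERIV_exp)
  moreover have "(\<lambda>x. exp (f x)) differentiable (at x)" for x
    using differentiable_chain_at[of f x exp] Ck_Suc_differentiable[OF Suc.prems]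
      field_differentiable_imp_differentiable[OF field_differentiable_within_exp[of "f x" UNIV]]
    by (simp add: o_def)
  moreover have "Ck k (\<lambda>x. exp (f x))" using Suc Ck_mono_Suc by blast
  ultimately show ?case using Suc.prems by (auto intro!: Ck_mult simp: differentiable_on_def)
qed (auto intro: continuous_intros)

lemma Ck_inverse: "Ck k f \<Longrightarrow> (\<And>x. f x \<noteq> 0) \<Longrightarrow> Ck k (\<lambda>x. inverse (f x))"
proof (induction k arbitrary: f)
  case (Suc k)
  have "partial b (\<lambda>x. inverse (f x)) = (\<lambda>x. (-1) * (inverse (f x) * inverse (f x)) * partial b f x)" for b
    by (intro ext partial_compose)
      (use Suc.prems in \<open>auto simp: differentiable_on_def intro!: derivative_eq_intros\<close>)
  moreover have "(\<lambda>x. inverse (f x)) differentiable (at x)" for x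
    using Ck_Suc_differentiable[OF Suc.prems(1)] Suc.prems(2) by (intro differentiable_inverse) auto
  moreover have "Ck k (\<lambda>x. inverse (f x))" using Suc Ck_mono_Suc by blast
  moreover have "Ck k (\<lambda>x. (-1) * (inverse (f x) * inverse (f x)) * partial b f x)" if "b \<in> Basis" for b
    using calculation(3) Suc.prems(1) that by (intro Ck_mult Ck_const) auto
  ultimately show ?case by (simp add: differentiable_on_def)
qed (auto intro: continuous_intros)

lemma partial_inner_self: "partial b (\<lambda>x. x \<bullet> x) x = 2 * (x \<bullet> b)"
  by (rule partial_eqI[where D="\<lambda>h. 2 * (x \<bullet> h)", simplified])
    (auto intro!: derivative_eq_intros simp: inner_commute)

lemma partial_inner_left: "partial b (\<lambda>x. x \<bullet> a) x = b \<bullet> a"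
  by (rule partial_eqI) (auto intro!: derivative_eq_intros)

lemma Ck_inner_left: "Ck k (\<lambda>x. x \<bullet> a)"
  by (cases k) (auto intro!: continuous_intros simp: partial_inner_left[abs_def] 
      simp flip: fun_eq_iff intro: bounded_linear_imp_differentiable_on bounded_linear_inner_left)

lemma Ck_inner_self: "Ck k (\<lambda>x. x \<bullet> x)"
proof -
  have "Ck k (\<lambda>x. \<Sum>b\<in>Basis. (x \<bullet> b) * (x \<bullet> b))"
    by (intro Ck_sum Ck_mult Ck_inner_left)
  then show ?thesis by (simp flip: euclidean_inner)
qed

lemma has_derivative_partial:
  assumes "f differentiable (at x)"
  shows "(f has_derivative (\<lambda>h. \<Sum>b\<in>Basis. (h \<bullet> b) * partial b f x)) (at x)"
proof -
  let ?D = "frechet_derivative f (at x)"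
  have d: "(f has_derivative ?D) (at x)" using assms by (simp add: frechet_derivative_works)
  then interpret D: linear ?D by (rule has_derivative_linear)
  have "?D h = (\<Sum>b\<in>Basis. (h \<bullet> b) * partial b f x)" for h
    by (subst euclidean_representation[of h, symmetric])
      (simp only: D.sum D.scale partial_def real_scaleR_def)
  then have "?D = (\<lambda>h. \<Sum>b\<in>Basis. (h \<bullet> b) * partial b f x)" by blast
  with d show ?thesis by simp
qed

lemma has_real_derivative_along:
  assumes "f differentiable (at (x + t *\<^sub>R b))"
  shows "((\<lambda>t. f (x + t *\<^sub>R b)) has_real_derivative partial b f (x + t *\<^sub>R b)) (at t)"
proof -
  let ?D = "frechet_derivative f (at (x + t *\<^sub>R b))"
  have d: "(f has_derivative ?D) (at (x + t *\<^sub>R b))" using assms by (simp add: frechet_derivative_works)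
  have "((\<lambda>t. f (x + t *\<^sub>R b)) has_derivative (\<lambda>h. ?D (h *\<^sub>R b))) (at t)"
    by (rule has_derivative_compose[where f="\<lambda>t. x + t *\<^sub>R b" and g=f]) (auto intro!: derivative_eq_intros d)
  moreover have "?D (h *\<^sub>R b) = partial b f (x + t *\<^sub>R b) * h" for h
    using linear_scale[OF has_derivative_linear[OF d]] by (simp add: partial_def)
  ultimately show ?thesis by (simp add: has_field_derivative_def)
qed

lemma Ck_laplacian: "Ck (Suc (Suc k)) f \<Longrightarrow> Ck k (laplacian f)"
  unfolding laplacian_def[abs_def] by (rule Ck_sum) auto

lemma smooth_neg_laplacian_pow: "smooth f \<Longrightarrow> smooth (neg_laplacian_pow m f)"
proof (induction m)
  case (Suc m)
  have "Ck k (\<lambda>x. (-1) * laplacian (neg_laplacian_pow m f) x)" for k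
    using Suc by (intro Ck_mult Ck_laplacian) (auto simp: smooth_def)
  then show ?case by (simp add: smooth_def neg_laplacian_pow_def)
qed (simp add: neg_laplacian_pow_def)

subsection \<open>The Laplacian and barriers\<close>

text \<open>\<open>Ck 2\<close> is a condition on the whole space, while the barrier with
  \<open>c < 0\<close> blows up on a sphere. This pointwise form suffices for linearity of the
  Laplacian and for the second derivative test.\<close>

definition twice_differentiable_at :: "('a::euclidean_space \<Rightarrow> real) \<Rightarrow> 'a \<Rightarrow> bool" where
  "twice_differentiable_at f x \<longleftrightarrow>
    (\<forall>\<^sub>F y in nhds x. f differentiable (at y)) \<and> (\<forall>b\<in>Basis. partial b f differentiable (at x))"

lemma Ck2_twice_differentiable_at: "Ck 2 f \<Longrightarrow> twice_differentiable_at f x"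
  by (auto simp: twice_differentiable_at_def numeral_2_eq_2 differentiable_on_def)

lemma has_derivative_cong_nhds:
  assumes "\<forall>\<^sub>F y in nhds x. f y = g y"
  shows "(f has_derivative D) (at x) \<longleftrightarrow> (g has_derivative D) (at x)"
proof -
  have "f x = g x" "\<forall>\<^sub>F y in at x. f y = g y"
    using assms by (auto dest: eventually_nhds_x_imp_x simp: eventually_at_filter elim: eventually_mono)
  then show ?thesis
    by (auto elim!: has_derivative_transform_eventually elim: eventually_mono)
qed

lemma partial_cong_nhds: "\<forall>\<^sub>F y in nhds x. f y = g y \<Longrightarrow> partial b f x = partial b g x"
  by (simp add: partial_def frechet_derivative_def has_derivative_cong_nhds)

lemma differentiable_cong_nhds:
  "\<forall>\<^sub>F y in nhds x. f y = g y \<Longrightarrow> f differentiable (at x) \<longleftrightarrow> g differentiable (at x)"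
  by (simp add: differentiable_def has_derivative_cong_nhds)

lemma
  assumes "twice_differentiable_at f x" "twice_differentiable_at g x"
  shows twice_differentiable_at_add: "twice_differentiable_at (\<lambda>x. f x + g x) x"
    and laplacian_add: "laplacian (\<lambda>x. f x + g x) x = laplacian f x + laplacian g x"
proof -
  have ev: "\<forall>\<^sub>F y in nhds x. f differentiable (at y) \<and> g differentiable (at y)"
    using assms by (auto simp: twice_differentiable_at_def eventually_conj_iff)
  have eq: "\<forall>\<^sub>F y in nhds x. partial b (\<lambda>x. f x + g x) y = partial b f y + partial b g y" for b
    using ev by eventually_elim (simp add: partial_add)
  have d: "partial b f differentiable (at x)" "partial b g differentiable (at x)" if "b \<in> Basis" for b
    using assms that by (auto simp: twice_differentiable_at_def)
  show "twice_differentiable_at (\<lambda>x. f x + g x) x"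
    using ev d by (auto simp: twice_differentiable_at_def differentiable_cong_nhds[OF eq] elim: eventually_mono)
  show "laplacian (\<lambda>x. f x + g x) x = laplacian f x + laplacian g x"
    using d by (simp add: laplacian_def partial_cong_nhds[OF eq] partial_add sum.distrib)
qed

lemma
  assumes "twice_differentiable_at f x"
  shows twice_differentiable_at_cmult: "twice_differentiable_at (\<lambda>x. c * f x) x"
    and laplacian_cmult: "laplacian (\<lambda>x. c * f x) x = c * laplacian f x"
proof -
  have ev: "\<forall>\<^sub>F y in nhds x. f differentiable (at y)"
    using assms by (auto simp: twice_differentiable_at_def)
  have p: "partial b (\<lambda>x. c * f x) y = c * partial b f y" if "f differentiable (at y)" for f y and b :: 'a
    using that by (rule partial_compose) (auto intro!: derivative_eq_intros)
  have eq: "\<forall>\<^sub>F y in nhds x. partial b (\<lambda>x. c * f x) y = c * partial b f y" for b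
    using ev by eventually_elim (rule p)
  have d: "partial b f differentiable (at x)" if "b \<in> Basis" for b
    using assms that by (auto simp: twice_differentiable_at_def)
  show "twice_differentiable_at (\<lambda>x. c * f x) x"
    using ev d by (auto simp: twice_differentiable_at_def differentiable_cong_nhds[OF eq] elim: eventually_mono)
  show "laplacian (\<lambda>x. c * f x) x = c * laplacian f x"
    using d by (simp add: laplacian_def partial_cong_nhds[OF eq] p sum_distrib_left)
qed

lemma norm_grad: "(norm (grad f x))\<^sup>2 = (\<Sum>b\<in>Basis. (partial b f x)\<^sup>2)"
  unfolding power2_norm_eq_inner grad_def
  by (simp add: inner_sum_left inner_sum_right inner_Basis if_distrib power2_eq_square cong: if_cong)

lemma laplacian_exp:
  assumes "Ck 2 f"
  shows "laplacian (\<lambda>x. exp (a * f x)) x = a * exp (a * f x) * (laplacian f x + a * (norm (grad f x))\<^sup>2)"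
proof -
  have df: "f differentiable (at x)" for x using assms by (auto simp: numeral_2_eq_2 differentiable_on_def)
  have e: "partial b (\<lambda>x. exp (a * f x)) x = (a * exp (a * f x)) * partial b f x" for b x
    by (rule partial_compose[OF df]) (auto intro!: derivative_eq_intros)
  have "(\<lambda>x. a * exp (a * f x)) differentiable (at x)" for x
    by (rule Ck_Suc_differentiable[of 0]) (intro Ck_mult Ck_exp Ck_const Ck_mono[OF assms], simp_all)
  moreover have "partial b f differentiable (at x)" if "b \<in> Basis" for b
    using assms that by (auto simp: numeral_2_eq_2 differentiable_on_def)
  ultimately have e2: "partial b (\<lambda>x. (a * exp (a * f x)) * partial b f x) x =
      a * exp (a * f x) * partial b (partial b f) x + partial b (\<lambda>x. a * exp (a * f x)) x * partial b f x"
    if "b \<in> Basis" for b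
    using that by (intro partial_mult)
  have "partial b (\<lambda>x. a * exp (a * f x)) x = (a * a * exp (a * f x)) * partial b f x" for b
    by (rule partial_compose[OF df]) (auto intro!: derivative_eq_intros)
  then have "partial b (partial b (\<lambda>x. exp (a * f x))) x =
     a * exp (a * f x) * (partial b (partial b f) x + a * (partial b f x)\<^sup>2)" if "b \<in> Basis" for b
    using e2[OF that] by (simp only: e[abs_def]) (simp add: power2_eq_square algebra_simps)
  then show ?thesis
    by (simp add: laplacian_def norm_grad sum_distrib_left sum.distrib distrib_left)
qed

text \<open>Along each axis the first derivative vanishes at the minimum. A negative second
  derivative would make it negative just to the right, and by the mean value theorem the function
  would drop below its minimum.\<close>

lemma laplacian_nonneg_at_local_min:
  assumes f: "twice_differentiable_at f x" and min: "\<forall>\<^sub>F y in nhds x. f x \<le> f y"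
  shows "0 \<le> laplacian f x"
  unfolding laplacian_def
proof (rule sum_nonneg)
  fix b :: 'a assume b: "b \<in> Basis"
  have "\<forall>\<^sub>F y in nhds x. f differentiable (at y) \<and> f x \<le> f y"
    using f min by (auto simp: twice_differentiable_at_def eventually_conj_iff)
  then obtain e where e: "e > 0" "\<And>y. dist y x < e \<Longrightarrow> f differentiable (at y) \<and> f x \<le> f y"
    by (auto simp: eventually_nhds_metric)
  define g g' where "g t = f (x + t *\<^sub>R b)" and "g' t = partial b f (x + t *\<^sub>R b)" for t
  have g: "(g has_real_derivative g' t) (at t)" "g 0 \<le> g t" if "\<bar>t\<bar> < e" for t
    using that b e(2)[of "x + t *\<^sub>R b"] has_real_derivative_along[of f x t b]
    by (auto simp: g_def[abs_def] g'_def dist_norm)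
  have "g' 0 = 0" using DERIV_local_min[OF g(1)[of 0] e(1)] g(2) e(1) by auto
  have g': "(g' has_real_derivative partial b (partial b f) x) (at 0)"
    using has_real_derivative_along[of "partial b f" x 0 b] f b
    by (auto simp: g'_def[abs_def] twice_differentiable_at_def)
  show "0 \<le> partial b (partial b f) x"
  proof (rule ccontr)
    assume "\<not> ?thesis"
    then obtain d where d: "d > 0" "\<And>h. 0 < h \<Longrightarrow> h < d \<Longrightarrow> g' h < 0"
      using DERIV_neg_dec_right[OF g'] \<open>g' 0 = 0\<close> by auto
    define h where "h = min d e / 2"
    have h: "0 < h" "h < d" "h < e" using d e by (auto simp: h_def)
    obtain z where "0 < z" "z < h" "g h - g 0 = (h - 0) * g' z"
      using MVT2[of 0 h g g'] h g(1) by force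
    then show False using d(2)[of z] g(2)[of h] h by (smt (verit) mult_pos_neg)
  qed
qed

text \<open>In dimension \<open>2p + 2\<close> the function \<open>(|x|\<^sup>2 + c)\<^bsup>-p\<^esup>\<close> is superharmonic for \<open>c > 0\<close> and subharmonic
  for \<open>c < 0\<close>, which provides barriers of both kinds with the decay of the fundamental solution.\<close>

definition barrier :: "nat \<Rightarrow> real \<Rightarrow> 'a::euclidean_space \<Rightarrow> real" where
  "barrier p c x = inverse (x \<bullet> x + c) ^ p"

lemma partial_barrier:
  assumes "x \<bullet> x + c > 0"
  shows "partial b (barrier p c) x = - 2 * p * (x \<bullet> b) * barrier (p + 1) c x"
proof -
  have "((\<lambda>s. inverse (s + c) ^ p) has_real_derivative
      p * (- (inverse (x \<bullet> x + c) * inverse (x \<bullet> x + c)) * inverse (x \<bullet> x + c) ^ (p - Suc 0))) (at (x \<bullet> x))"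
    using assms by (auto intro!: derivative_eq_intros)
  then have "((\<lambda>s. inverse (s + c) ^ p) has_real_derivative - (p * barrier (p + 1) c x)) (at (x \<bullet> x))"
    by (cases p) (simp_all add: barrier_def mult_ac)
  from partial_compose[OF Ck_Suc_differentiable[OF Ck_inner_self[of "Suc 0"]] this, of b]
  show ?thesis by (simp add: barrier_def[abs_def] partial_inner_self)
qed

lemma
  fixes x :: "'a::euclidean_space"
  assumes pos: "x \<bullet> x + c > 0"
  shows barrier_differentiable: "barrier p c differentiable (at x)"
    and twice_differentiable_at_barrier: "twice_differentiable_at (barrier p c) x"
    and laplacian_barrier:
      "laplacian (barrier p c) x = 
        2 * real p * (2 * (real p + 1) * (x \<bullet> x) * barrier (p + 2) c x - real DIM('a) * barrier (p + 1) c x)"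
proof -
  have D: "barrier p c differentiable (at x)" if "x \<bullet> x + c > 0" for p and x :: 'a
    unfolding barrier_def using that Ck_Suc_differentiable[OF Ck_inner_self[of "Suc 0"]]
    by (intro differentiable_power differentiable_inverse differentiable_add) auto
  show "barrier p c differentiable (at x)" using D pos .
  have "open {x :: 'a. x \<bullet> x + c > 0}"
    by (intro open_Collect_less continuous_intros)
  then have ev: "\<forall>\<^sub>F y in nhds x. y \<bullet> y + c > 0"
    using pos by (auto simp: eventually_nhds)
  have eq: "\<forall>\<^sub>F y in nhds x. partial b (barrier p c) y = (- 2 * p * (y \<bullet> b)) * barrier (p + 1) c y" for b
    using ev by eventually_elim (simp add: partial_barrier)
  have d: "(\<lambda>y. - 2 * p * (y \<bullet> b)) differentiable (at x)" for b :: 'a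
    using Ck_Suc_differentiable[OF Ck_inner_left[of "Suc 0"]] by (intro differentiable_mult) auto
  then show "twice_differentiable_at (barrier p c) x"
    using ev D pos by (auto simp: twice_differentiable_at_def differentiable_cong_nhds[OF eq] elim!: eventually_mono
        intro!: differentiable_mult)
  have "partial b (\<lambda>y. - 2 * p * (y \<bullet> b)) x = - 2 * p" if "b \<in> Basis" for b
    using that by (subst partial_eqI[where D="\<lambda>h. - 2 * p * (h \<bullet> b)"]) (auto intro!: derivative_eq_intros)
  then have "partial b (partial b (barrier p c)) x = 
      4 * p * (p + 1) * barrier (p + 2) c x * ((x \<bullet> b) * (x \<bullet> b)) - 2 * p * barrier (p + 1) c x" if "b \<in> Basis" for b
    unfolding partial_cong_nhds[OF eq] using that pos
    by (simp only: partial_mult[OF d D[OF pos]] partial_barrier; simp add: algebra_simps)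
  then show "laplacian (barrier p c) x = 
        2 * real p * (2 * (real p + 1) * (x \<bullet> x) * barrier (p + 2) c x - real DIM('a) * barrier (p + 1) c x)"
    by (simp add: laplacian_def sum_subtractf flip: sum_distrib_left euclidean_inner; simp add: algebra_simps)
qed

text \<open>With \<open>barrier (p + 1) c x\<close> written as \<open>x \<bullet> x + c\<close>
  times \<open>barrier (p + 2) c x\<close>, the terms in \<open>x \<bullet> x\<close> cancel in this
  dimension and only a term in \<open>c\<close> remains.\<close>

lemma laplacian_barrier':
  fixes x :: "'a::euclidean_space"
  assumes pos: "x \<bullet> x + c > 0" and dim: "DIM('a) = 2 * p + 2"
  shows "laplacian (barrier p c) x = - 4 * p * (p + 1) * c * barrier (p + 2) c x"
proof -
  have "barrier (p + 1) c x = (x \<bullet> x + c) * barrier (p + 2) c x"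
    using pos by (simp add: barrier_def)
  then show ?thesis
    unfolding laplacian_barrier[OF pos] dim by (simp only:) (simp add: algebra_simps)
qed

lemma Ck_barrier: "c > 0 \<Longrightarrow> Ck k (barrier p c)"
proof -
  assume "c > 0"
  moreover have "x \<bullet> x + c \<noteq> 0" for x :: 'a using \<open>c > 0\<close> inner_ge_zero[of x] by linarith
  ultimately show ?thesis unfolding barrier_def[abs_def]
    by (intro Ck_power Ck_inverse Ck_add Ck_inner_self Ck_const) auto
qed

subsection \<open>Weighted ball means\<close>

lemma
  fixes f :: "'a::euclidean_space \<Rightarrow> real"
  assumes f: "continuous_on UNIV f" and supp: "\<And>y. y \<notin> cbox a b \<Longrightarrow> f y = 0"
  shows integrable_supported_cbox: "integrable lborel f"
    and lborel_integral_supported_cbox: "(LINT y|lborel. f y) = integral (cbox a b) f"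
proof -
  have eq: "(\<lambda>y. indicator (cbox a b) y *\<^sub>R f y) = f"
  proof
    fix y show "indicator (cbox a b) y *\<^sub>R f y = f y" using supp[of y] by (cases "y \<in> cbox a b") auto
  qed
  have "integrable lborel (\<lambda>y. indicator (cbox a b) y *\<^sub>R f y)"
    using f by (intro borel_integrable_compact continuous_on_subset[OF f]) auto
  then show i: "integrable lborel f" by (simp only: eq)
  then have "(f has_integral (LINT y|lborel. f y)) UNIV"
    by (rule has_integral_integral_lborel)
  then have "((\<lambda>y. if y \<in> cbox a b then f y else 0) has_integral (LINT y|lborel. f y)) UNIV"
    by (rule has_integral_eq[rotated]) (use supp in auto)
  then have "(f has_integral (LINT y|lborel. f y)) (cbox a b)"
    by (simp only: has_integral_restrict_UNIV)
  then show "(LINT y|lborel. f y) = integral (cbox a b) f"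
    by (simp add: integral_unique)
qed

lemma integrable_bounded_support:
  fixes f :: "'a::euclidean_space \<Rightarrow> real"
  assumes "continuous_on UNIV f" "bounded {y. f y \<noteq> 0}"
  shows "integrable lborel f"
proof -
  obtain a where "{y. f y \<noteq> 0} \<subseteq> cbox (-a) a"
    using bounded_subset_cbox_symmetric[OF assms(2)] by blast
  then show ?thesis by (intro integrable_supported_cbox[of f "-a" a] assms) auto
qed

lemma DERIV_lborel_integral:
  fixes g g' :: "real \<Rightarrow> 'a::euclidean_space \<Rightarrow> real"
  assumes U: "open U" "convex U" "t0 \<in> U"
    and der: "\<And>t y. t \<in> U \<Longrightarrow> ((\<lambda>t. g t y) has_real_derivative g' t y) (at t)"
    and contg: "\<And>t. t \<in> U \<Longrightarrow> continuous_on UNIV (g t)"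
    and cont: "continuous_on (U \<times> UNIV) (\<lambda>(t, y). g' t y)"
    and supp: "bounded S" "\<And>t y. t \<in> U \<Longrightarrow> y \<notin> S \<Longrightarrow> g t y = 0"
  shows "((\<lambda>t. LINT y|lborel. g t y) has_real_derivative (LINT y|lborel. g' t0 y)) (at t0)"
proof -
  obtain a where S: "S \<subseteq> cbox (-a) a"
    using bounded_subset_cbox_symmetric[OF supp(1)] by blast
  have sg: "g t y = 0" if "t \<in> U" "y \<notin> cbox (-a) a" for t y
    using that S supp(2) by blast
  \<comment> \<open>For fixed \<open>y\<close> off the box, \<open>g t y\<close> vanishes for all
    \<open>t\<close> in the open set \<open>U\<close>, so its derivative in \<open>t\<close>
    vanishes as well.\<close>
  have sg': "g' t y = 0" if "t \<in> U" "y \<notin> cbox (-a) a" for t y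
  proof -
    have "((\<lambda>t. 0) has_real_derivative g' t y) (at t)"
      by (rule has_field_derivative_transform_within_open[OF der U(1)]) (use that sg in auto)
    then show ?thesis using DERIV_unique DERIV_const by blast
  qed
  have "((\<lambda>t. integral (cbox (-a) a) (g t)) has_real_derivative integral (cbox (-a) a) (g' t0)) (at t0 within U)"
  proof (rule leibniz_rule_field_derivative[OF _ _ _ U(3,2)])
    show "((\<lambda>t. g t y) has_real_derivative g' t y) (at t within U)" if "t \<in> U" for t y
      by (rule has_field_derivative_at_within[OF der[OF that]])
    show "g t integrable_on cbox (-a) a" if "t \<in> U" for t
      by (rule integrable_continuous[OF continuous_on_subset[OF contg[OF that] subset_UNIV]])
    show "continuous_on (U \<times> cbox (-a) a) (\<lambda>(t, y). g' t y)"
      by (rule continuous_on_subset[OF cont]) auto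
  qed
  then have "((\<lambda>t. integral (cbox (-a) a) (g t)) has_real_derivative integral (cbox (-a) a) (g' t0)) (at t0)"
    by (simp only: at_within_open[OF U(3,1)])
  moreover have "continuous_on UNIV (g' t0)"
  proof -
    have "continuous_on UNIV (\<lambda>y::'a. (t0, y))" by (intro continuous_intros)
    from continuous_on_compose2[OF cont this] U(3) show ?thesis by (simp add: image_subset_iff)
  qed
  ultimately have "((\<lambda>t. integral (cbox (-a) a) (g t)) has_real_derivative (LINT y|lborel. g' t0 y)) (at t0)"
    using lborel_integral_supported_cbox[of "g' t0" "-a" a] sg'[OF U(3)] by simp
  then show ?thesis
  proof (rule has_field_derivative_transform_within_open[OF _ U(1,3)])
    show "integral (cbox (-a) a) (g t) = (LINT y|lborel. g t y)" if "t \<in> U" for t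
      using lborel_integral_supported_cbox[OF contg[OF that] sg[OF that]] by simp
  qed
qed

lemma lborel_integral_affine:
  fixes f :: "'a::euclidean_space \<Rightarrow> real"
  assumes [measurable]: "f \<in> borel_measurable borel" and c: "c > 0"
  shows "(LINT x|lborel. f x) = c ^ DIM('a) * (LINT y|lborel. f (t + c *\<^sub>R y))"
proof -
  have "(LINT x|lborel. f x) = (LINT x|density (distr lborel borel (\<lambda>x. t + c *\<^sub>R x)) (\<lambda>_. \<bar>c\<bar>^DIM('a)). f x)"
    using c lborel_affine[of c t] by simp
  also have "\<dots> = c ^ DIM('a) * (LINT y|lborel. f (t + c *\<^sub>R y))"
    using c by (subst integral_density) (auto simp: integral_distr)
  finally show ?thesis .
qed

text \<open>The translates of \<open>f\<close> all have the same integral; differentiate.\<close>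

lemma integral_partial_eq_0:
  fixes f :: "'a::euclidean_space \<Rightarrow> real"
  assumes f: "Ck 1 f" and supp: "bounded {y. f y \<noteq> 0}" and b: "b \<in> Basis"
  shows "(LINT y|lborel. partial b f y) = 0"
proof -
  have c: "continuous_on UNIV (partial b f)" and cf: "continuous_on UNIV f"
    using f b Ck_imp_continuous_on[OF f] by auto
  obtain R where R: "\<And>y. f y \<noteq> 0 \<Longrightarrow> norm y \<le> R"
    using supp by (auto simp: bounded_iff)
  have "((\<lambda>t. LINT y|lborel. f (y + t *\<^sub>R b)) has_real_derivative (LINT y|lborel. partial b f (y + 0 *\<^sub>R b))) (at 0)"
  proof (rule DERIV_lborel_integral[of "{-1<..<1}" _ _ _ "cball 0 (R + 1)"])
    show "((\<lambda>t. f (y + t *\<^sub>R b)) has_real_derivative partial b f (y + t *\<^sub>R b)) (at t)" for t y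
      using f by (intro has_real_derivative_along) (auto simp: differentiable_on_def)
    show "continuous_on UNIV (\<lambda>y. f (y + t *\<^sub>R b))" for t
      by (intro continuous_on_compose2[OF cf] continuous_intros) auto
    show "continuous_on ({- 1<..<1} \<times> UNIV) (\<lambda>(t, y). partial b f (y + t *\<^sub>R b))"
      unfolding split_beta by (intro continuous_on_compose2[OF c] continuous_intros) auto
    show "f (y + t *\<^sub>R b) = 0" if "t \<in> {-1<..<1}" "y \<notin> cball 0 (R + 1)" for t y
    proof (rule ccontr)
      assume "f (y + t *\<^sub>R b) \<noteq> 0"
      then have "norm (y + t *\<^sub>R b) \<le> R" by (rule R)
      moreover have "norm y \<le> norm (y + t *\<^sub>R b) + norm (t *\<^sub>R b)"
        using norm_triangle_ineq4[of "y + t *\<^sub>R b" "t *\<^sub>R b"] by simp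
      moreover have "norm (t *\<^sub>R b) < 1" "R + 1 < norm y"
        using that b by (simp_all add: abs_less_iff)
      ultimately show False by linarith
    qed
  qed simp_all
  moreover have "(LINT y|lborel. f (y + t *\<^sub>R b)) = (LINT y|lborel. f y)" for t
    using lborel_integral_affine[OF borel_measurable_continuous_onI[OF cf], of 1 "t *\<^sub>R b"]
    by (simp add: add.commute)
  ultimately have "((\<lambda>t::real. LINT y|lborel. f y) has_real_derivative (LINT y|lborel. partial b f y)) (at 0)"
    by simp
  then show ?thesis using DERIV_unique DERIV_const by blast
qed

text \<open>The weight is cut off outside the unit ball only for \<open>k \<ge> 1\<close>: \<open>psi 0\<close> is constantly \<open>1\<close>.\<close>

definition psi :: "nat \<Rightarrow> 'a::euclidean_space \<Rightarrow> real" where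
  "psi k y = max 0 (1 - y \<bullet> y) ^ k"

text \<open>Only \<open>s = 0\<close> is delicate: there the difference quotient is at most
  \<open>max 0 h ^ k\<close> in absolute value, which tends to 0 because k \<ge> 1.\<close>

lemma DERIV_max_power:
  assumes "k \<ge> 1"
  shows "((\<lambda>s::real. max 0 s ^ Suc k) has_real_derivative real (Suc k) * max 0 s ^ k) (at s)"
proof -
  consider "s < 0" | "s = 0" | "s > 0" by linarith
  then show ?thesis
  proof cases
    case 1
    then have "((\<lambda>s. 0) has_real_derivative real (Suc k) * max 0 s ^ k) (at s)"
      using assms by (simp add: zero_power)
    then show ?thesis
      by (rule has_field_derivative_transform_within_open[of _ _ _ "{..<0}"]) (use 1 in auto)
  next
    case 2
    have "norm ((max 0 h ^ Suc k - 0) / h) \<le> max 0 h ^ k" for h :: real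
      by (cases "h > 0") (simp_all add: max.absorb2 max.absorb1)
    then have "\<forall>\<^sub>F h::real in at 0. norm ((max 0 h ^ Suc k - 0) / h) \<le> max 0 h ^ k" 
      by (intro always_eventually allI)
    moreover have "((\<lambda>h::real. max 0 h ^ k) \<longlongrightarrow> max 0 0 ^ k) (at 0)"
      by (intro tendsto_intros)
    then have "((\<lambda>h::real. max 0 h ^ k) \<longlongrightarrow> 0) (at 0)"
      using assms by (simp add: zero_power)
    ultimately have "((\<lambda>h::real. (max 0 h ^ Suc k - 0) / h) \<longlongrightarrow> 0) (at 0)"
      by (rule Lim_null_comparison)
    then show ?thesis using 2 assms by (simp add: DERIV_def zero_power)
  next
    case 3
    have "((\<lambda>s. s ^ Suc k) has_real_derivative real (Suc k) * max 0 s ^ k) (at s)"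
      using 3 DERIV_pow[of "Suc k" s] by simp
    then show ?thesis
      by (rule has_field_derivative_transform_within_open[of _ _ _ "{0<..}"]) (use 3 in auto)
  qed
qed

lemma psi_nonneg [simp]: "0 \<le> psi k y"
  by (simp add: psi_def)

lemma psi_le_1 [simp]: "psi k y \<le> 1"
  by (auto simp: psi_def max_def intro!: power_le_one)

lemma psi_eq_0: "k \<ge> 1 \<Longrightarrow> norm y \<ge> 1 \<Longrightarrow> psi k y = 0"
  by (auto simp: psi_def dot_square_norm one_le_power max.absorb1 zero_power)

lemma psi_bounded_support: "k \<ge> 1 \<Longrightarrow> bounded {y. psi k y * f y \<noteq> 0}"
  by (rule bounded_subset[of "cball 0 1"]) (auto intro: psi_eq_0 simp: not_le[symmetric])

lemma continuous_on_psi: "continuous_on S (psi k)"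
  unfolding psi_def[abs_def] by (intro continuous_intros)

text \<open>Thus the position vector times \<open>psi k\<close> is a gradient, up to the factor -1 /
  (2 (k + 1)). An integration by parts can then trade a radial derivative for a Laplacian under the
  next weight.\<close>

lemma
  assumes "k \<ge> 1"
  shows partial_psi: "partial b (psi (Suc k)) y = - 2 * real (Suc k) * ((y \<bullet> b) * psi k y)"
    and differentiable_psi: "psi (Suc k) differentiable (at y)"
proof -
  have d: "((\<lambda>y::'a. 1 - y \<bullet> y) has_derivative (\<lambda>h. - 2 * (y \<bullet> h))) (at y)"
    by (auto intro!: derivative_eq_intros simp: inner_commute)
  have D: "(psi (Suc k) has_derivative (\<lambda>h. (real (Suc k) * max 0 (1 - y \<bullet> y) ^ k) * (- 2 * (y \<bullet> h)))) (at y)"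
    unfolding psi_def[abs_def]
    using has_derivative_compose[OF d DERIV_max_power[OF assms, unfolded has_field_derivative_def]] by simp
  then show "psi (Suc k) differentiable (at y)" by (rule differentiableI)
  show "partial b (psi (Suc k)) y = - 2 * real (Suc k) * ((y \<bullet> b) * psi k y)"
    using partial_eqI[OF D, of b] by (simp add: psi_def algebra_simps)
qed

lemma Ck1_psi: "k \<ge> 1 \<Longrightarrow> Ck 1 (psi (Suc k))"
  using continuous_on_psi[of UNIV k]
  by (auto simp: differentiable_on_def partial_psi differentiable_psi cong: continuous_on_cong intro!: continuous_intros)

lemma partial_affine:
  assumes "f differentiable (at (x + r *\<^sub>R y))"
  shows "partial b (\<lambda>y. f (x + r *\<^sub>R y)) y = r * partial b f (x + r *\<^sub>R y)"
    and "(\<lambda>y. f (x + r *\<^sub>R y)) differentiable (at y)"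
proof -
  let ?D = "frechet_derivative f (at (x + r *\<^sub>R y))"
  have d: "(f has_derivative ?D) (at (x + r *\<^sub>R y))" using assms by (simp add: frechet_derivative_works)
  have D: "((\<lambda>y. f (x + r *\<^sub>R y)) has_derivative (\<lambda>h. ?D (r *\<^sub>R h))) (at y)"
    by (rule has_derivative_compose[where f="\<lambda>y. x + r *\<^sub>R y" and g=f]) (auto intro!: derivative_eq_intros d)
  then show "(\<lambda>y. f (x + r *\<^sub>R y)) differentiable (at y)" by (rule differentiableI)
  show "partial b (\<lambda>y. f (x + r *\<^sub>R y)) y = r * partial b f (x + r *\<^sub>R y)"
    using partial_eqI[OF D] linear_scale[OF has_derivative_linear[OF d]] by (simp add: partial_def)
qed

lemma Ck_affine: "Ck k f \<Longrightarrow> Ck k (\<lambda>y. f (x + r *\<^sub>R y))"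
proof (induction k arbitrary: f)
  case 0
  then show ?case by (auto intro!: continuous_on_compose2[of UNIV f] continuous_intros)
next
  case (Suc k)
  have d: "f differentiable (at y)" for y using Suc.prems by (rule Ck_Suc_differentiable)
  have "partial b (\<lambda>y. f (x + r *\<^sub>R y)) = (\<lambda>y. r * partial b f (x + r *\<^sub>R y))" for b
    using d by (intro ext partial_affine)
  moreover have "Ck k (\<lambda>y. r * partial b f (x + r *\<^sub>R y))" if "b \<in> Basis" for b
    using Suc.IH[of "partial b f"] Suc.prems that by (intro Ck_mult Ck_const) auto
  moreover have "(\<lambda>y. f (x + r *\<^sub>R y)) differentiable (at y)" for y
    using d by (rule partial_affine(2))
  ultimately show ?case by (simp add: differentiable_on_def)
qed

text \<open>Not normalised: the mass of \<open>psi k\<close> remains as a factor. Scaling the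
  argument of \<open>f\<close> keeps the integrand supported in the closed unit ball for k \<ge> 1,
  whatever \<open>r\<close>, and allows \<open>r = 0\<close>.\<close>

definition wmean :: "nat \<Rightarrow> ('a::euclidean_space \<Rightarrow> real) \<Rightarrow> 'a \<Rightarrow> real \<Rightarrow> real" where
  "wmean k f x r = (LINT y|lborel. psi k y * f (x + r *\<^sub>R y))"

lemma continuous_on_psi_mult:
  assumes "continuous_on UNIV f"
  shows "continuous_on UNIV (\<lambda>y. psi k y * f (x + r *\<^sub>R y))"
  by (intro continuous_on_mult continuous_on_psi continuous_on_compose2[OF assms])
    (auto intro!: continuous_intros)

lemma integrable_wmean:
  "k \<ge> 1 \<Longrightarrow> continuous_on UNIV f \<Longrightarrow> integrable lborel (\<lambda>y. psi k y * f (x + r *\<^sub>R y))"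
  by (intro integrable_bounded_support continuous_on_psi_mult psi_bounded_support)

text \<open>Differentiation under the integral yields y . grad f against \<open>psi k\<close>.
  Integrating by parts in each coordinate with the gradient of \<open>psi (Suc k)\<close> absorbs
  the factor y, and the inner derivative of \<open>f (x + r *\<^sub>R y)\<close> supplies the factor
  \<open>r\<close>.\<close>

lemma DERIV_wmean:
  assumes k: "k \<ge> 1" and f: "Ck 2 f"
  shows "(wmean k f x has_real_derivative r / (2 * real (Suc k)) * wmean (Suc k) (laplacian f) x r) (at r)"
proof -
  have df: "f differentiable (at y)" for y using f by (auto simp: numeral_2_eq_2 differentiable_on_def)
  have f1: "Ck 1 (partial b f)" if "b \<in> Basis" for b using f that by (auto simp: numeral_2_eq_2)
  have dp: "partial b f differentiable (at y)" if "b \<in> Basis" for b y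
    using f1[OF that] Ck_Suc_differentiable[of 0] by simp
  have cp: "continuous_on UNIV (partial b f)" if "b \<in> Basis" for b
    using Ck_imp_continuous_on[OF f1[OF that]] .
  have cpp: "continuous_on UNIV (partial b (partial b f))" if "b \<in> Basis" for b
    using f1[OF that] that by simp
  let ?P = "\<lambda>b y. psi k y * ((y \<bullet> b) * partial b f (x + r *\<^sub>R y))"
  let ?L = "\<lambda>b y. psi (Suc k) y * partial b (partial b f) (x + r *\<^sub>R y)"
  have intP: "integrable lborel (?P b)" if "b \<in> Basis" for b
    by (intro integrable_bounded_support psi_bounded_support k continuous_on_mult continuous_on_psi
        continuous_on_compose2[OF cp[OF that]]) (auto intro!: continuous_intros)
  have intL: "integrable lborel (?L b)" if "b \<in> Basis" for b
    using cpp[OF that] by (intro integrable_wmean) auto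
  have parts: "2 * real (Suc k) * (LINT y|lborel. ?P b y) = r * (LINT y|lborel. ?L b y)" if b: "b \<in> Basis" for b
  proof -
    let ?F = "\<lambda>y. psi (Suc k) y * partial b f (x + r *\<^sub>R y)"
    have "partial b ?F y = r * ?L b y - 2 * real (Suc k) * ?P b y" for y
      using partial_mult[OF differentiable_psi[OF k] partial_affine(2)[OF dp[OF b]]]
        partial_affine(1)[OF dp[OF b]] partial_psi[OF k, of b y]
      by (simp add: algebra_simps del: of_nat_Suc)
    moreover have "(LINT y|lborel. partial b ?F y) = 0"
    proof (rule integral_partial_eq_0[OF _ _ b])
      show "Ck 1 ?F" by (intro Ck_mult Ck1_psi k Ck_affine f1 b)
      show "bounded {y. ?F y \<noteq> 0}" by (rule psi_bounded_support) simp
    qed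
    ultimately show ?thesis using intP[OF b] intL[OF b] by (simp del: of_nat_Suc)
  qed
  have "((\<lambda>r. LINT y|lborel. psi k y * f (x + r *\<^sub>R y)) has_real_derivative
      (LINT y|lborel. psi k y * (\<Sum>b\<in>Basis. (y \<bullet> b) * partial b f (x + r *\<^sub>R y)))) (at r)"
  proof (rule DERIV_lborel_integral[of UNIV _ _ _ "cball 0 1"])
    fix t y
    have "((\<lambda>t. f (x + t *\<^sub>R y)) has_derivative (\<lambda>h. \<Sum>b\<in>Basis. ((h *\<^sub>R y) \<bullet> b) * partial b f (x + t *\<^sub>R y))) (at t)"
      by (rule has_derivative_compose[where f="\<lambda>t. x + t *\<^sub>R y" and g=f])
        (auto intro!: derivative_eq_intros has_derivative_partial[OF df, simplified])
    then have "((\<lambda>t. f (x + t *\<^sub>R y)) has_real_derivative (\<Sum>b\<in>Basis. (y \<bullet> b) * partial b f (x + t *\<^sub>R y))) (at t)"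
      by (rule has_derivative_imp_has_field_derivative) (simp add: sum_distrib_left sum_distrib_right mult_ac)
    then show "((\<lambda>t. psi k y * f (x + t *\<^sub>R y)) has_real_derivative 
        psi k y * (\<Sum>b\<in>Basis. (y \<bullet> b) * partial b f (x + t *\<^sub>R y))) (at t)"
      by (rule DERIV_cmult)
    show "continuous_on UNIV (\<lambda>y. psi k y * f (x + t *\<^sub>R y))"
      using Ck_imp_continuous_on[OF f] by (rule continuous_on_psi_mult)
    show "y \<notin> cball 0 1 \<Longrightarrow> psi k y * f (x + t *\<^sub>R y) = 0"
      using psi_eq_0[OF k, of y] by simp
  qed (auto simp: split_beta intro!: continuous_intros continuous_on_compose2[OF continuous_on_psi]
      continuous_on_compose2[OF cp])
  also have "(LINT y|lborel. psi k y * (\<Sum>b\<in>Basis. (y \<bullet> b) * partial b f (x + r *\<^sub>R y))) = (\<Sum>b\<in>Basis. LINT y|lborel. ?P b y)"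
    using intP by (simp add: sum_distrib_left)
  also have "\<dots> = (\<Sum>b\<in>Basis. r / (2 * real (Suc k)) * (LINT y|lborel. ?L b y))"
    using parts by (intro sum.cong refl) (simp add: field_simps del: of_nat_Suc)
  also have "\<dots> = r / (2 * real (Suc k)) * wmean (Suc k) (laplacian f) x r"
    using intL by (simp add: wmean_def laplacian_def sum_distrib_left)
  finally show ?thesis by (simp add: wmean_def[abs_def])
qed

text \<open>\<open>E\<close> is a solid paraboloid whose fibre over \<open>y\<close> has length
  \<open>psi 1 y\<close>. Slicing it at height \<open>t\<close> instead gives balls of radius sqrt
  (1 - t), whose volumes are integrated over \<open>t\<close>.\<close>

lemma nn_integral_psi_1:
  assumes dim: "DIM('a::euclidean_space) = 2 * m"
  shows "(\<integral>\<^sup>+y. ennreal (psi 1 (y::'a)) \<partial>lborel) = ennreal (pi ^ m / fact (m + 1))"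
proof -
  define E where "E = {z :: 'a \<times> real. 0 < snd z \<and> snd z + fst z \<bullet> fst z < 1}"
  have "open E" unfolding E_def
    by (intro open_Collect_conj open_Collect_less continuous_intros)
  then have E [measurable]: "E \<in> sets (lborel \<Otimes>\<^sub>M lborel)" by (simp only: lborel_prod sets_lborel borel_open)
  have slice: "(\<integral>\<^sup>+t. indicator E (y, t) \<partial>lborel) = ennreal (psi 1 y)" for y :: 'a
  proof -
    have "(\<integral>\<^sup>+t. indicator E (y, t) \<partial>lborel) = (\<integral>\<^sup>+t. indicator {0<..<1 - y \<bullet> y} t \<partial>lborel)"
      by (intro nn_integral_cong) (auto simp: E_def indicator_def)
    also have "\<dots> = emeasure lborel {0<..<1 - y \<bullet> y}" by simp
    also have "\<dots> = ennreal (psi 1 y)" by (simp add: psi_def max_def)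
    finally show ?thesis .
  qed
  have "(\<integral>\<^sup>+y. ennreal (psi 1 (y::'a)) \<partial>lborel) = (\<integral>\<^sup>+y. (\<integral>\<^sup>+t. indicator E (y, t) \<partial>lborel) \<partial>lborel)"
    by (simp only: slice)
  also have "\<dots> = (\<integral>\<^sup>+t. (\<integral>\<^sup>+y. indicator E (y, t) \<partial>lborel) \<partial>lborel)"
    by (rule lborel_pair.Fubini'[symmetric]) simp
  also have "\<dots> = (\<integral>\<^sup>+t. ennreal (pi ^ m / fact m * (1 - t) ^ m) * indicator {0..1} t \<partial>lborel)"
  \<comment> \<open>At \<open>t = 0\<close> the slice is empty while the closed formula is positive;
    the endpoints are left out as a null set.\<close>
  proof (rule nn_integral_finite_cong[of "{0, 1}"])
    fix t :: real assume t: "t \<notin> {0, 1}"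
    show "(\<integral>\<^sup>+y. indicator E (y, t) \<partial>lborel) = ennreal (pi ^ m / fact m * (1 - t) ^ m) * indicator {0..1} t"
    proof (cases "0 < t \<and> t < 1")
      case True
      have "(y, t) \<in> E \<longleftrightarrow> y \<in> ball 0 (sqrt (1 - t))" for y
        using True real_less_rsqrt[of "norm y" "1 - t"] power_strict_mono[of "norm y" "sqrt (1 - t)" 2]
        by (auto simp: E_def dot_square_norm)
      then have "(\<integral>\<^sup>+y. indicator E (y, t) \<partial>lborel) = (\<integral>\<^sup>+y. indicator (ball (0::'a) (sqrt (1 - t))) y \<partial>lborel)"
        by (intro nn_integral_cong) (auto simp: indicator_def)
      also have "\<dots> = emeasure lborel (ball (0::'a) (sqrt (1 - t)))" by simp
      also have "\<dots> = ennreal (pi ^ m / fact m * (1 - t) ^ m)"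
        using True emeasure_ball[of "sqrt (1 - t)" "0::'a"] 
        by (simp add: dim power_mult unit_ball_vol_even[unfolded of_nat_mult of_nat_numeral])
      finally show ?thesis using True by simp
    next
      case False
      then have "(y, t) \<notin> E" for y
        unfolding E_def mem_Collect_eq fst_conv snd_conv using inner_ge_zero[of y] by linarith
      with False t show ?thesis by (auto simp: indicator_def)
    qed
  qed simp
  also have "\<dots> = ennreal (- (pi ^ m / fact m * (1 - 1) ^ Suc m / Suc m) - (- (pi ^ m / fact m * (1 - 0) ^ Suc m / Suc m)))"
  proof (rule nn_integral_FTC_Icc)
    fix t :: real
    have "((\<lambda>t. (1 - t) ^ Suc m) has_real_derivative - (real (Suc m) * (1 - t) ^ m)) (at t)"
      by (rule derivative_eq_intros refl | simp)+
    then have "((\<lambda>t. - (pi ^ m / fact m) / Suc m * (1 - t) ^ Suc m) has_real_derivative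
        - (pi ^ m / fact m) / Suc m * - (real (Suc m) * (1 - t) ^ m)) (at t)"
      by (rule DERIV_cmult)
    then show "((\<lambda>t. - (pi ^ m / fact m * (1 - t) ^ Suc m / Suc m)) has_real_derivative
        pi ^ m / fact m * (1 - t) ^ m) (at t)"
      by (simp del: of_nat_Suc power_Suc)
  qed auto
  also have "\<dots> = ennreal (pi ^ m / fact (m + 1))" by (simp add: field_simps)
  finally show ?thesis .
qed

lemma integral_psi_1:
  assumes "DIM('a::euclidean_space) = 2 * m"
  shows "(LINT y::'a|lborel. psi 1 y) = pi ^ m / fact (m + 1)"
  using nn_integral_psi_1[OF assms]
  by (subst integral_eq_nn_integral) (auto intro!: borel_measurable_continuous_onI continuous_on_psi)

section \<open>Mean value, comparison and Jensen inequalities\<close>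

lemma integral_psi_scaled:
  fixes W :: "'a::euclidean_space \<Rightarrow> real"
  assumes W: "continuous_on UNIV W" and r: "r > 0"
  shows "(LINT z|lborel. psi k ((1 / r) *\<^sub>R (z - x)) * W z) = r ^ DIM('a) * wmean k W x r"
proof -
  have "continuous_on UNIV (\<lambda>z. psi k ((1 / r) *\<^sub>R (z - x)) * W z)"
    by (intro continuous_on_mult W continuous_on_compose2[OF continuous_on_psi[of UNIV]] continuous_intros) auto
  from lborel_integral_affine[OF borel_measurable_continuous_onI[OF this] r, of x]
  show ?thesis using r by (simp add: wmean_def)
qed

text \<open>By \<open>DERIV_wmean\<close> the mean of a superharmonic function is nonincreasing in
  the radius, and at radius 0 it is the value at the centre times the mass of the weight.\<close>

lemma wmean_le_center:
  fixes W :: "'a::euclidean_space \<Rightarrow> real"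
  assumes W: "Ck 2 W" and super: "\<And>x. laplacian W x \<le> 0" and r: "r \<ge> 0"
  shows "wmean 1 W x r \<le> (LINT y::'a|lborel. psi 1 y) * W x"
proof -
  have "wmean 1 W x r \<le> wmean 1 W x 0"
    using r
  proof (rule DERIV_nonpos_imp_nonincreasing)
    fix t :: real assume t: "0 \<le> t" "t \<le> r"
    have "wmean (Suc 1) (laplacian W) x t \<le> 0"
      unfolding wmean_def using integral_nonneg_AE[where M=lborel and f="\<lambda>y. - (psi (Suc 1) y * laplacian W (x + t *\<^sub>R y))"]
      by (simp add: mult_nonneg_nonpos super)
    then show "\<exists>d. (wmean 1 W x has_real_derivative d) (at t) \<and> d \<le> 0"
      using t DERIV_wmean[OF le_refl W, of x t] by (meson divide_nonneg_pos mult_nonneg_nonpos mult_pos_pos of_nat_0_less_iff zero_less_Suc zero_less_numeral)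
  qed
  then show ?thesis by (simp add: wmean_def)
qed

text \<open>Change of centre: the ball of radius \<open>norm x\<close> about 0 lies in the ball of
  radius \<open>2 * norm x\<close> about \<open>x\<close>, where the weight of radius
  \<open>3 * norm x\<close> is at least 1 - (2/3)^2 = 5/9. The power of 3 is the ratio of the two
  scaling factors.\<close>

lemma wmean_1_compare:
  fixes W :: "'a::euclidean_space \<Rightarrow> real"
  assumes W: "continuous_on UNIV W" "\<And>x. W x \<ge> 0" and x: "x \<noteq> 0"
  shows "5 / (9 * 3 ^ DIM('a)) * wmean 1 W 0 (norm x) \<le> wmean 1 W x (3 * norm x)"
proof -
  define r where "r = norm x"
  have r: "r > 0" using x by (simp add: r_def)
  have int: "integrable lborel (\<lambda>z. psi 1 ((1 / s) *\<^sub>R (z - c)) * W z)" if "s > 0" for s and c :: 'a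
  proof (rule integrable_bounded_support)
    show "continuous_on UNIV (\<lambda>z. psi 1 ((1 / s) *\<^sub>R (z - c)) * W z)"
      by (intro continuous_on_mult W continuous_on_compose2[OF continuous_on_psi[of UNIV]] continuous_intros) auto
    have "dist c z \<le> s" if "psi 1 ((1 / s) *\<^sub>R (z - c)) * W z \<noteq> 0" for z
    proof -
      have "norm ((1 / s) *\<^sub>R (z - c)) = dist c z / s"
        using \<open>s > 0\<close> by (simp add: dist_norm norm_minus_commute)
      moreover have "norm ((1 / s) *\<^sub>R (z - c)) < 1" 
        using psi_eq_0[of 1 "(1 / s) *\<^sub>R (z - c)"] that by fastforce
      ultimately have "dist c z / s < 1" by (simp only:)
      then show ?thesis using \<open>s > 0\<close> by (simp add: field_simps)
    qed
    then show "bounded {z. psi 1 ((1 / s) *\<^sub>R (z - c)) * W z \<noteq> 0}"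
      by (intro bounded_subset[OF bounded_cball[of c s]]) auto
  qed
  have le: "5 / 9 * psi 1 ((1 / r) *\<^sub>R (z - 0)) \<le> psi 1 ((1 / (3 * r)) *\<^sub>R (z - x))" for z
  proof (cases "norm z \<ge> r")
    case True
    then show ?thesis using psi_eq_0[of 1 "(1 / r) *\<^sub>R z"] r by (simp add: field_simps)
  next
    case False
    have "norm (z - x) \<le> 2 * r" using norm_triangle_ineq4[of z x] False by (simp add: r_def)
    moreover have "norm ((1 / (3 * r)) *\<^sub>R (z - x)) = norm (z - x) / (3 * r)" using r by simp
    moreover have "norm (z - x) / (3 * r) \<le> 2 / 3" if "norm (z - x) \<le> 2 * r"
      using that r by (simp add: field_simps)
    ultimately have "norm ((1 / (3 * r)) *\<^sub>R (z - x)) \<le> 2 / 3" by metis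
    then have "(norm ((1 / (3 * r)) *\<^sub>R (z - x)))\<^sup>2 \<le> (2 / 3)\<^sup>2" by (rule power_mono) simp
    then have "5 / 9 \<le> psi 1 ((1 / (3 * r)) *\<^sub>R (z - x))"
      unfolding psi_def dot_square_norm by (simp add: power2_eq_square)
    moreover have "psi 1 ((1 / r) *\<^sub>R (z - 0)) \<le> 1" by simp
    ultimately show ?thesis by linarith
  qed
  have "5 / 9 * (r ^ DIM('a) * wmean 1 W 0 r) = (LINT z|lborel. 5 / 9 * (psi 1 ((1 / r) *\<^sub>R (z - 0)) * W z))"
    using integral_psi_scaled[OF W(1) r, of 1 0] by simp
  also have "\<dots> \<le> (LINT z|lborel. psi 1 ((1 / (3 * r)) *\<^sub>R (z - x)) * W z)"
  proof (rule integral_mono)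
    show "5 / 9 * (psi 1 ((1 / r) *\<^sub>R (z - 0)) * W z) \<le> psi 1 ((1 / (3 * r)) *\<^sub>R (z - x)) * W z" for z
      using mult_right_mono[OF le[of z] W(2)[of z]] by (simp add: mult.assoc)
    show "integrable lborel (\<lambda>z. 5 / 9 * (psi 1 ((1 / r) *\<^sub>R (z - 0)) * W z))"
      by (intro integrable_mult_right int r)
    show "integrable lborel (\<lambda>z. psi 1 ((1 / (3 * r)) *\<^sub>R (z - x)) * W z)"
      using r by (intro int) simp
  qed
  also have "\<dots> = (3 * r) ^ DIM('a) * wmean 1 W x (3 * r)"
    using r by (intro integral_psi_scaled W) simp
  finally have "r ^ DIM('a) * (5 / 9 * wmean 1 W 0 r) \<le> r ^ DIM('a) * (3 ^ DIM('a) * wmean 1 W x (3 * r))"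
    by (simp add: power_mult_distrib mult_ac)
  then show ?thesis using r by (simp add: r_def field_simps)
qed

lemma wmean_mono:
  assumes "k \<ge> 1" "continuous_on UNIV f" "continuous_on UNIV g" "\<And>y. psi k y \<noteq> 0 \<Longrightarrow> f (x + r *\<^sub>R y) \<le> g (x + r *\<^sub>R y)"
  shows "wmean k f x r \<le> wmean k g x r"
  unfolding wmean_def
proof (rule integral_mono)
  show "psi k y * f (x + r *\<^sub>R y) \<le> psi k y * g (x + r *\<^sub>R y)" for y
    using assms(4)[of y] by (cases "psi k y = 0") (simp_all add: mult_left_mono)
qed (use assms integrable_wmean in blast)+

text \<open>Jensen's inequality, by integrating the tangent line inequality at the mean.\<close>

lemma wmean_exp_ge:
  fixes u :: "'a::euclidean_space \<Rightarrow> real"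
  defines "V \<equiv> LINT y::'a|lborel. psi 1 y"
  assumes u: "continuous_on UNIV u" and V: "V > 0"
  shows "V * exp (a * (wmean 1 u x r / V)) \<le> wmean 1 (\<lambda>x. exp (a * u x)) x r"
proof -
  define A where "A = wmean 1 u x r / V"
  let ?g = "\<lambda>z. exp (a * A) * (1 - a * A) * 1 + exp (a * A) * a * u z"
  have ge: "?g z \<le> exp (a * u z)" for z
  proof -
    have "exp (a * A) * (1 + (a * u z - a * A)) \<le> exp (a * A) * exp (a * u z - a * A)"
      by (intro mult_left_mono exp_ge_add_one_self) simp
    then show ?thesis by (simp add: exp_diff algebra_simps)
  qed
  have i1: "integrable lborel (\<lambda>y::'a. psi 1 y * 1)"
    using integrable_wmean[of 1 "\<lambda>_::'a. 1" x r] by simp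
  have iu: "integrable lborel (\<lambda>y. psi 1 y * u (x + r *\<^sub>R y))"
    using u by (intro integrable_wmean) auto
  have "V * exp (a * A) = exp (a * A) * (1 - a * A) * V + exp (a * A) * a * wmean 1 u x r"
    using V by (simp add: A_def field_simps)
  also have "\<dots> = (LINT y|lborel. exp (a * A) * (1 - a * A) * (psi 1 y * 1) + exp (a * A) * a * (psi 1 y * u (x + r *\<^sub>R y)))"
    by (subst Bochner_Integration.integral_add)
      (use i1 iu in \<open>simp_all add: V_def wmean_def integrable_mult_right\<close>)
  also have "\<dots> = wmean 1 ?g x r"
    unfolding wmean_def by (intro Bochner_Integration.integral_cong) (simp_all add: algebra_simps)
  also have "\<dots> \<le> wmean 1 (\<lambda>x. exp (a * u x)) x r"
    using ge by (intro wmean_mono continuous_intros u) auto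
  finally show ?thesis by (simp add: A_def)
qed

subsection \<open>A minimum principle and an asymptotic lemma\<close>

text \<open>Minimum principle: the difference of \<open>w\<close> and a multiple of the barrier is
  nonnegative on the inner sphere, and far out it is almost nonnegative because \<open>w\<close> is
  positive and the barrier decays. A negative value would force an interior minimum in some
  annulus.\<close>

lemma exterior_barrier_lower_bound:
  fixes w :: "'a::euclidean_space \<Rightarrow> real"
  assumes dim: "DIM('a) = 2 * p + 2" and p: "p \<ge> 1" and w: "Ck 2 w" and pos: "\<And>x. w x > 0"
    and R: "R > 1" and super: "\<And>x. norm x \<ge> R \<Longrightarrow> laplacian w x \<le> 0"
  obtains d where "d > 0" "\<And>x. norm x \<ge> R \<Longrightarrow> d * barrier p (-1) x \<le> w x"
proof -
  have cw: "continuous_on S w" for S using Ck_imp_continuous_on[OF w] .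
  have gt1: "x \<bullet> x + (-1) > 0" if "norm x \<ge> R" for x :: 'a
    using that R one_less_power[of "norm x" 2] by (simp add: dot_square_norm)
  have bpos: "barrier k (-1) x > 0" if "norm x \<ge> R" for x :: 'a and k
    using gt1[OF that] by (simp add: barrier_def)
  have "sphere (0::'a) R \<noteq> {}" using R by simp
  then obtain z where z: "norm z = R" "\<And>x. norm x = R \<Longrightarrow> w z \<le> w x"
    using continuous_attains_inf[OF compact_sphere[of 0 R] _ cw] by auto
  \<comment> \<open>The barrier is radial, so this is the largest factor for which
    \<open>d * barrier p (-1)\<close> stays below \<open>w\<close> on the inner sphere.\<close>
  define d where "d = w z / barrier p (-1) z"
  have d: "d > 0" unfolding d_def using pos[of z] bpos[of z] z by simp
  define f where "f x = w x + (- d) * barrier p (-1) x" for x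
  have f_sphere: "f x \<ge> 0" if "norm x = R" for x
  proof -
    have "barrier p (-1) x = barrier p (-1) z" using that z by (simp add: barrier_def dot_square_norm)
    then have "d * barrier p (-1) x = w z" using bpos[of z p] z by (simp add: d_def)
    then show ?thesis using z(2)[OF that] by (simp add: f_def)
  qed
  have "f x \<ge> 0" if x: "norm x \<ge> R" for x
  proof (rule ccontr)
    assume neg: "\<not> f x \<ge> 0"
    \<comment> \<open>Choice of the outer radius: on the sphere of radius \<open>r\<close> the
      barrier term is below \<open>- f x\<close>, so \<open>f\<close> exceeds \<open>f x\<close>
      there and its minimum over the annulus is not attained on that sphere.\<close>
    have "filterlim (\<lambda>r::real. - 1 + r\<^sup>2) at_top at_top"
      by (intro filterlim_tendsto_add_at_top[OF tendsto_const] filterlim_pow_at_top filterlim_ident) simp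
    then have "((\<lambda>r::real. d * inverse (- 1 + r\<^sup>2) ^ p) \<longlongrightarrow> d * 0 ^ p) at_top"
      by (intro tendsto_intros tendsto_inverse_0_at_top)
    then have "\<forall>\<^sub>F r in at_top. d * inverse (- 1 + r\<^sup>2) ^ p < - f x"
      by (rule order_tendstoD) (use neg p in \<open>auto simp: zero_power\<close>)
    then have "\<forall>\<^sub>F r in at_top. d * inverse (- 1 + r\<^sup>2) ^ p < - f x \<and> norm x < r"
      using eventually_gt_at_top eventually_conj by blast
    then obtain r where r: "d * inverse (- 1 + r\<^sup>2) ^ p < - f x" "norm x < r"
      using eventually_happens'[OF trivial_limit_at_top_linorder] by blast
    define A where "A = cball (0::'a) r - ball 0 R"
    have "compact A" unfolding A_def by (intro compact_diff) auto
    moreover have "x \<in> A" using x r by (auto simp: A_def)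
    moreover have "continuous_on A f"
      unfolding f_def[abs_def]
    proof (intro continuous_intros cw continuous_at_imp_continuous_on ballI)
      fix y assume "y \<in> A"
      then show "isCont (barrier p (- 1)) y"
        using gt1[of y] by (intro differentiable_imp_continuous_within barrier_differentiable) (auto simp: A_def)
    qed
    ultimately obtain y where y: "y \<in> A" "\<And>z. z \<in> A \<Longrightarrow> f y \<le> f z"
      using continuous_attains_inf[of A f] by blast
    have fy: "f y \<le> f x" using y \<open>x \<in> A\<close> by blast
    have "norm y \<noteq> R" using fy f_sphere[of y] neg by auto
    moreover have "norm y \<noteq> r"
    proof
      assume "norm y = r"
      then have "d * barrier p (-1) y < - f x" using r by (simp add: barrier_def dot_square_norm)
      then show False using fy pos[of y] by (simp add: f_def)
    qed
    ultimately have yA: "norm y > R" "norm y < r" using y by (auto simp: A_def)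
    have "open (ball 0 r - cball (0::'a) R)" "y \<in> ball 0 r - cball 0 R" using yA by auto
    then have "\<forall>\<^sub>F z in nhds y. f y \<le> f z"
      unfolding eventually_nhds by (intro exI[of _ "ball 0 r - cball 0 R"]) (auto intro!: y simp: A_def)
    moreover have b: "twice_differentiable_at (barrier p (-1)) y"
      using yA gt1[of y] by (intro twice_differentiable_at_barrier) simp
    moreover have t: "twice_differentiable_at w y" "twice_differentiable_at (\<lambda>x. (- d) * barrier p (-1) x) y"
      by (fact Ck2_twice_differentiable_at[OF w] twice_differentiable_at_cmult[OF b])+
    ultimately have "0 \<le> laplacian f y"
      unfolding f_def[abs_def] by (intro laplacian_nonneg_at_local_min twice_differentiable_at_add)
    also have "laplacian f y = laplacian w y + (- d) * laplacian (barrier p (-1)) y"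
      unfolding f_def[abs_def] by (simp only: laplacian_add[OF t] laplacian_cmult[OF b])
    \<comment> \<open>The value \<open>c = -1\<close> makes the barrier strictly subharmonic, so the
      sum is strictly negative although \<open>w\<close> is only superharmonic.\<close>
    also have "\<dots> < 0"
    proof -
      have "laplacian (barrier p (-1)) y = 4 * real p * (real p + 1) * barrier (p + 2) (-1) y"
        using laplacian_barrier'[OF _ dim, of y "-1"] gt1[of y] yA by simp
      also have "\<dots> > 0" using bpos[of y "p + 2"] yA p by simp
      finally have "d * laplacian (barrier p (-1)) y > 0" using d by simp
      then show ?thesis using super[of y] yA by simp
    qed
    finally show False by simp
  qed
  then have "d * barrier p (-1) x \<le> w x" if "norm x \<ge> R" for x
    using that by (force simp: f_def)
  with d show ?thesis by (rule that)
qed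

text \<open>One integration turns a positive lower bound for a derivative into linear growth of the
  function. Linear growth eventually exceeds 1, which restarts the argument one level lower with
  \<open>d = 1\<close>.\<close>

lemma eventually_linear_growth:
  fixes T :: "nat \<Rightarrow> real \<Rightarrow> real"
  assumes "\<And>i s. i < j \<Longrightarrow> s > a \<Longrightarrow> (T i has_real_derivative T (Suc i) s) (at s)"
    and "\<forall>\<^sub>F s in at_top. T j s \<ge> d" "d > 0" "j \<ge> 1"
  shows "\<exists>c>0. \<forall>\<^sub>F s in at_top. T 0 s \<ge> c * s"
  using assms
proof (induction j arbitrary: d)
  case (Suc j)
  obtain b where b: "b > a" "b > 0" "\<And>s. s \<ge> b \<Longrightarrow> T (Suc j) s \<ge> d"
  proof -
    obtain b where "\<And>s. s \<ge> b \<Longrightarrow> T (Suc j) s \<ge> d"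
      using Suc.prems(2) by (auto simp: eventually_at_top_linorder)
    then show ?thesis using that[of "max 1 (max b (a + 1))"] by auto
  qed
  have lin: "T j s \<ge> T j b + d * (s - b)" if "s \<ge> b" for s
  proof -
    have "T j b - d * b \<le> T j s - d * s"
    proof (rule DERIV_nonneg_imp_nondecreasing[OF that])
      fix t assume "b \<le> t" "t \<le> s"
      then show "\<exists>y. ((\<lambda>s. T j s - d * s) has_real_derivative y) (at t) \<and> 0 \<le> y"
        using b by (intro exI[of _ "T (Suc j) t - d"]) (auto intro!: derivative_eq_intros Suc.prems(1))
    qed
    then show ?thesis by (simp add: algebra_simps)
  qed
  have "filterlim (\<lambda>s. d / 2 * s) at_top at_top" using Suc.prems(3)
    by (intro filterlim_tendsto_pos_mult_at_top[OF tendsto_const] filterlim_ident) simp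
  then have ev: "\<forall>\<^sub>F s in at_top. d * b - T j b \<le> d / 2 * s" "\<forall>\<^sub>F s in at_top. 1 \<le> d / 2 * s"
    unfolding filterlim_at_top by blast+
  have grow: "\<forall>\<^sub>F s in at_top. T j s \<ge> d / 2 * s"
    using ev(1) eventually_ge_at_top[of b]
  proof eventually_elim
    case (elim s)
    then show ?case using lin[of s] by (simp add: right_diff_distrib)
  qed
  show ?case
  proof (cases "j = 0")
    case True
    then show ?thesis using grow Suc.prems(3) by (intro exI[of _ "d / 2"]) auto
  next
    case False
    have "\<forall>\<^sub>F s in at_top. T j s \<ge> 1" using grow ev(2) by eventually_elim linarith
    with False show ?thesis using Suc.prems(1) by (intro Suc.IH[of 1]) auto
  qed
qed simp

text \<open>If \<open>Y\<^sub>m\<close> ever becomes positive, \<open>Y\<^sub>0\<close> eventually dominates a nonzero multiple of \<open>s\<close> in absolute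
  value, and the growth hypothesis fixes the sign; otherwise \<open>m\<close> can be lowered.\<close>

lemma iterated_derivative_bounded_below:
  fixes Y :: "nat \<Rightarrow> real \<Rightarrow> real"
  assumes "\<And>i s. i < m \<Longrightarrow> s > a \<Longrightarrow> (Y i has_real_derivative - Y (Suc i) s) (at s)"
    and "\<forall>\<^sub>F s in at_top. Y m s \<le> 0" "m \<ge> 1"
    and sublin: "\<And>c. c > 0 \<Longrightarrow> \<forall>\<^sub>F s in at_top. Y 0 s \<ge> - c * s"
  shows "\<exists>C. \<forall>\<^sub>F s in at_top. Y 0 s \<ge> C"
  using assms(1-3)
proof (induction m)
  case (Suc m)
  obtain b where b: "b > a" "\<And>s. s \<ge> b \<Longrightarrow> Y (Suc m) s \<le> 0"
  proof -
    obtain b where "\<And>s. s \<ge> b \<Longrightarrow> Y (Suc m) s \<le> 0"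
      using Suc.prems(2) by (auto simp: eventually_at_top_linorder)
    then show ?thesis using that[of "max b (a + 1)"] by auto
  qed
  have mono: "Y m s \<le> Y m t" if "b \<le> s" "s \<le> t" for s t
    using that(2)
  proof (rule DERIV_nonneg_imp_nondecreasing)
    fix x assume "s \<le> x" "x \<le> t"
    then show "\<exists>y. (Y m has_real_derivative y) (at x) \<and> 0 \<le> y"
      using b that Suc.prems(1)[of m x] by (intro exI[of _ "- Y (Suc m) x"]) auto
  qed
  \<comment> \<open>For \<open>m = 0\<close> the nondecreasing \<open>Y 0\<close> is bounded below
    by its value at \<open>b\<close>. Otherwise \<open>Y m\<close> stays nonpositive and the
    induction hypothesis applies, or monotonicity keeps it above a positive constant.\<close>
  consider "m = 0" | "m \<ge> 1" "\<And>s. s \<ge> b \<Longrightarrow> Y m s \<le> 0" | s where "m \<ge> 1" "s \<ge> b" "Y m s > 0"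
    by fastforce
  then show ?case
  proof cases
    case 1
    then show ?thesis using mono[of b] by (auto simp: eventually_at_top_linorder)
  next
    case 2
    then have "\<forall>\<^sub>F s in at_top. Y m s \<le> 0" by (auto simp: eventually_at_top_linorder)
    with 2 show ?thesis using Suc.prems(1) by (intro Suc.IH) auto
  next
    case 3
    have ge: "\<forall>\<^sub>F t in at_top. Y m t \<ge> Y m s"
      using 3 mono[of s] by (auto simp: eventually_at_top_linorder)
    \<comment> \<open>The alternating signs turn Y i' = - Y (i + 1) into T i' = T (i + 1) with
      \<open>T m = Y m\<close>. For odd \<open>m\<close> the resulting growth of
      \<open>T 0 = - Y 0\<close> contradicts the growth hypothesis at \<open>c / 2\<close>.\<close>
    define T where "T i t = (-1) ^ (m + i) * Y i t" for i t
    have dT: "(T i has_real_derivative T (Suc i) t) (at t)" if "i < m" "t > a" for i t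
      using DERIV_cmult[OF Suc.prems(1)[of i t], of "(-1) ^ (m + i)"] that by (simp add: T_def[abs_def])
    have "T m t = Y m t" for t by (simp add: T_def flip: mult_2)
    then obtain c where c: "c > 0" "\<forall>\<^sub>F t in at_top. T 0 t \<ge> c * t"
      using eventually_linear_growth[of m a T "Y m s"] dT ge 3 by auto
    show ?thesis
    proof (cases "even m")
      case True
      have "\<forall>\<^sub>F t in at_top. Y 0 t \<ge> 0"
        using c(2) eventually_ge_at_top[of 0] 
      proof eventually_elim
        case (elim t)
        then have "T 0 t = Y 0 t" "0 \<le> c * t" using True c(1) by (simp_all add: T_def)
        with elim show ?case by linarith
      qed
      then show ?thesis by blast
    next
      case False
      have "\<forall>\<^sub>F t in at_top. Y 0 t \<ge> - (c / 2) * t"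
        using c(1) by (intro sublin) simp
      then have "\<forall>\<^sub>F t::real in at_top. False"
        using c(2) eventually_gt_at_top[of 0]
      proof eventually_elim
        case (elim t)
        then have "T 0 t = - Y 0 t" "0 < c * t" using False c(1) by (simp_all add: T_def)
        with elim show ?case by simp
      qed
      then show ?thesis by simp
    qed
  qed
qed simp

subsection \<open>Superharmonicity of powers of the conformal factor\<close>

text \<open>Here (n - 2) / 2 = p, so the bracket in \<open>laplacian_exp\<close> with
  \<open>a = p\<close> is minus the one in \<open>scalar_curvature\<close>, whose prefactor is
  positive.\<close>

lemma laplacian_exp_nonpos:
  fixes u :: "'a::euclidean_space \<Rightarrow> real"
  assumes dim: "DIM('a) = 2 * p + 2" and u: "Ck 2 u" and R: "scalar_curvature u x \<ge> 0"
  shows "laplacian (\<lambda>x. exp (real p * u x)) x \<le> 0"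
proof -
  have "0 \<le> 2 * (real DIM('a) - 1) * exp (- 2 * u x) * (- laplacian u x - real p * (norm (grad u x))\<^sup>2)"
    using R dim by (simp add: scalar_curvature_def)
  moreover have "0 < 2 * (real DIM('a) - 1) * exp (- 2 * u x)" using dim by simp
  ultimately have "laplacian u x + real p * (norm (grad u x))\<^sup>2 \<le> 0"
    by (smt (verit) mult_pos_neg)
  then show ?thesis unfolding laplacian_exp[OF u] by (intro mult_nonneg_nonpos) auto
qed

lemma
  fixes u :: "'a::euclidean_space \<Rightarrow> real"
  defines "V \<equiv> LINT y::'a|lborel. psi 1 y"
  assumes dim: "DIM('a) = 2 * p + 2" and p: "p \<ge> 1" and u: "Ck 2 u"
    and R: "R > 1" and super: "\<And>x. norm x \<ge> R \<Longrightarrow> laplacian (\<lambda>x. exp (real p * u x)) x \<le> 0"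
  shows superharmonic_exp_log_lower_bound: "\<exists>C. \<forall>x. norm x \<ge> R \<longrightarrow> u x \<ge> - 2 * ln (norm x) - C"
    and superharmonic_exp_mean_lower_bound: "\<exists>C. \<forall>x. norm x \<ge> R \<longrightarrow> u x \<ge> wmean 1 u 0 (norm x) / V - C"
proof -
  define w where "w x = exp (real p * u x)" for x
  have w: "Ck 2 w" unfolding w_def[abs_def] by (intro Ck_exp Ck_mult Ck_const u)
  have wpos: "w x > 0" for x by (simp add: w_def)
  obtain d where d: "d > 0" "\<And>x. norm x \<ge> R \<Longrightarrow> d * barrier p (-1) x \<le> w x"
    using exterior_barrier_lower_bound[OF dim p w wpos R] super by (auto simp: w_def[abs_def])
  have sq: "norm x * norm x > 1" if "norm x \<ge> R" for x :: 'a
    using that R by (intro less_1_mult) auto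
  show "\<exists>C. \<forall>x. norm x \<ge> R \<longrightarrow> u x \<ge> - 2 * ln (norm x) - C"
  proof (intro exI allI impI)
    fix x :: 'a assume x: "norm x \<ge> R"
    \<comment> \<open>The barrier (|x|^2 - 1)^(-p) is at least |x|^(-2p); after the logarithm the
      factor \<open>p\<close> cancels against that in \<open>w\<close> and leaves the factor
      2.\<close>
    have "d * (inverse (norm x))\<^sup>2 ^ p \<le> d * barrier p (-1) x"
      unfolding barrier_def using d sq[OF x]
      by (intro mult_left_mono power_mono) (auto simp: dot_square_norm power2_eq_square field_simps)
    also have "\<dots> \<le> w x" by (rule d(2)[OF x])
    finally have "ln (d * (inverse (norm x))\<^sup>2 ^ p) \<le> ln (w x)"
      using d x R by (intro ln_mono) (auto intro!: mult_pos_pos zero_less_power)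
    moreover have "ln (d * (inverse (norm x))\<^sup>2 ^ p) = ln d - p * (2 * ln (norm x))"
    proof -
      have i: "inverse (norm x) > 0" using x R by (subst inverse_positive_iff_positive) linarith
      then have "ln (d * (inverse (norm x))\<^sup>2 ^ p) = ln d + ln ((inverse (norm x))\<^sup>2 ^ p)"
        using d by (intro ln_mult_pos) auto
      also have "ln ((inverse (norm x))\<^sup>2 ^ p) = p * (2 * ln (inverse (norm x)))"
        using i by (simp only: ln_realpow zero_less_power; simp)
      finally show ?thesis by (simp add: ln_inverse)
    qed
    ultimately have "ln d - p * (2 * ln (norm x)) \<le> p * u x" by (simp add: w_def)
    moreover have "p * (- 2 * ln (norm x) - (- ln d / p)) = ln d - p * (2 * ln (norm x))"
      using p by (simp add: right_diff_distrib)
    ultimately have "p * (- 2 * ln (norm x) - (- ln d / p)) \<le> p * u x" by linarith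
    then show "u x \<ge> - 2 * ln (norm x) - (- ln d / p)" using p by simp
  qed
  have V: "V > 0" using integral_psi_1[where 'a='a, of "p + 1"] dim by (simp add: V_def)
  have "continuous_on (cball 0 R) (laplacian w)"
    using w by (intro Ck_imp_continuous_on[of 0] Ck_laplacian) (simp add: numeral_2_eq_2)
  then have "bounded (laplacian w ` cball 0 R)"
    by (intro compact_imp_bounded compact_continuous_image) auto
  then obtain D where D: "D > 0" "\<And>x. norm x \<le> R \<Longrightarrow> \<bar>laplacian w x\<bar> \<le> D"
    by (auto simp: bounded_pos)
  \<comment> \<open>On the ball of radius \<open>R\<close>, \<open>h\<close> bounds the negative
    Laplacian of \<open>barrier p 1\<close> from below and \<open>D\<close> bounds the Laplacian of
    \<open>w\<close>. With \<open>K = D / h\<close> the correction outweighs \<open>w\<close>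
    inside, and it is superharmonic outside as well.\<close>
  define h where "h = 4 * real p * (real p + 1) * inverse (R\<^sup>2 + 1) ^ (p + 2)"
  have h: "h > 0" using p R by (simp add: h_def add_pos_pos)
  define K where "K = D / h"
  have K: "K > 0" using D h by (simp add: K_def)
  define W where "W x = w x + K * barrier p 1 x" for x
  have pos: "x \<bullet> x + 1 > 0" for x :: 'a using inner_ge_zero[of x] by linarith
  have bpos: "barrier k 1 x > 0" for k and x :: 'a using pos[of x] by (simp add: barrier_def)
  have W: "Ck 2 W" unfolding W_def[abs_def] by (intro Ck_add Ck_mult Ck_const w Ck_barrier) simp
  have Wge: "W x \<ge> w x" for x using bpos[of p x] K by (simp add: W_def)
  have superW: "laplacian W x \<le> 0" for x
  proof -
    have b: "Ck 2 (barrier p 1 :: 'a \<Rightarrow> real)" by (rule Ck_barrier) simp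
    have lb: "laplacian (barrier p 1) x = - (4 * real p * (real p + 1) * barrier (p + 2) 1 x)"
      using laplacian_barrier'[OF pos dim, of x] by simp
    have "laplacian W x = laplacian w x + K * laplacian (barrier p 1) x"
      unfolding W_def[abs_def] using w b
      by (simp only: laplacian_add laplacian_cmult Ck2_twice_differentiable_at twice_differentiable_at_cmult)
    also have "\<dots> \<le> 0"
    proof (cases "norm x \<ge> R")
      case True
      then have "laplacian w x \<le> 0" using super by (simp add: w_def[abs_def])
      moreover have "K * laplacian (barrier p 1) x \<le> 0"
        unfolding lb using K bpos[of "p + 2" x] by (intro mult_nonneg_nonpos) auto
      ultimately show ?thesis by simp
    next
      case False
      have "(norm x)\<^sup>2 \<le> R\<^sup>2" using False by (intro power_mono) auto
      then have "inverse (R\<^sup>2 + 1) ^ (p + 2) \<le> barrier (p + 2) 1 x"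
        unfolding barrier_def using pos[of x]
        by (intro power_mono le_imp_inverse_le) (auto simp: dot_square_norm add_nonneg_nonneg)
      then have "h \<le> - laplacian (barrier p 1) x"
        unfolding h_def lb minus_minus by (intro mult_left_mono) auto
      then have "K * h \<le> K * (- laplacian (barrier p 1) x)" using K by (intro mult_left_mono) auto
      then show ?thesis using D(2)[of x] False h by (simp add: K_def)
    qed
    finally show ?thesis .
  qed
  \<comment> \<open>The first factor is the cost of the change of centre in
    \<open>wmean_1_compare\<close>, the second that of replacing \<open>W\<close> by
    \<open>w\<close> outside the ball of radius \<open>R\<close>.\<close>
  define c where "c = 5 / (9 * 3 ^ DIM('a)) / (1 + K / d)"
  have kd: "1 + K / d > 0" using K d by (simp add: add_pos_pos)
  then have c: "c > 0" by (simp add: c_def)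
  show "\<exists>C. \<forall>x. norm x \<ge> R \<longrightarrow> u x \<ge> wmean 1 u 0 (norm x) / V - C"
  proof (intro exI allI impI)
    fix x :: 'a assume x: "norm x \<ge> R"
    define A where "A = wmean 1 u 0 (norm x) / V"
    have cW: "continuous_on UNIV W" "continuous_on UNIV w" "continuous_on UNIV u"
      using Ck_imp_continuous_on W w u by blast+
    \<comment> \<open>The chain is Jensen for \<open>w\<close>, then w \<le> W, the change of centre
      from 0 to \<open>x\<close>, and the mean value inequality at \<open>x\<close>.\<close>
    have "V * exp (p * A) \<le> wmean 1 w 0 (norm x)"
      using wmean_exp_ge[OF cW(3) V[unfolded V_def], of p 0 "norm x"] by (simp add: A_def V_def w_def[abs_def])
    also have "\<dots> \<le> wmean 1 W 0 (norm x)"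
      using Wge cW by (intro wmean_mono) auto
    finally have "5 / (9 * 3 ^ DIM('a)) * (V * exp (p * A)) \<le> 5 / (9 * 3 ^ DIM('a)) * wmean 1 W 0 (norm x)"
      by (intro mult_left_mono) auto
    also have "\<dots> \<le> wmean 1 W x (3 * norm x)"
      using x R order_trans[OF less_imp_le[OF wpos] Wge] by (intro wmean_1_compare cW) auto
    also have "\<dots> \<le> V * W x"
      unfolding V_def by (rule wmean_le_center[OF W superW]) simp
    finally have "V * (5 / (9 * 3 ^ DIM('a)) * exp (p * A)) \<le> V * W x" by (simp add: mult_ac)
    then have 1: "5 / (9 * 3 ^ DIM('a)) * exp (p * A) \<le> W x" using V by (rule mult_left_le_imp_le)
    have "barrier p 1 x \<le> barrier p (-1) x"
      unfolding barrier_def using sq[OF x]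
      by (intro power_mono le_imp_inverse_le) (auto simp: dot_square_norm power2_eq_square)
    also have "\<dots> \<le> w x / d" using d(2)[OF x] d(1) by (simp add: field_simps)
    finally have "K * barrier p 1 x \<le> K * (w x / d)" using K by (intro mult_left_mono) auto
    then have "W x \<le> (1 + K / d) * w x" by (simp add: W_def algebra_simps)
    with 1 have "5 / (9 * 3 ^ DIM('a)) * exp (p * A) \<le> (1 + K / d) * w x" by linarith
    then have "c * exp (p * A) \<le> w x" using kd unfolding c_def by (simp add: pos_divide_le_eq mult.commute)
    then have "ln (c * exp (p * A)) \<le> ln (w x)" using c by (intro ln_mono) auto
    then have "ln c + p * A \<le> p * u x" using c by (simp add: w_def ln_mult)
    moreover have "p * (A - (- ln c / p)) = ln c + p * A" using p by (simp add: distrib_left)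
    ultimately have "p * (A - (- ln c / p)) \<le> p * u x" by linarith
    then show "u x \<ge> wmean 1 u 0 (norm x) / V - (- ln c / p)" using p by (simp add: A_def)
  qed
qed

subsection \<open>Asymptotics of the means\<close>

text \<open>In the variable s = r^2 the factor r of \<open>DERIV_wmean\<close> cancels against dr/ds
  = 1 / (2 r). The derivative is a constant times another mean, so the formula can be
  iterated.\<close>

lemma DERIV_wmean_sqrt:
  assumes k: "k \<ge> 1" and f: "Ck 2 f" and s: "s > 0"
  shows "((\<lambda>s. wmean k f x (sqrt s)) has_real_derivative 
    wmean (Suc k) (laplacian f) x (sqrt s) / (4 * real (Suc k))) (at s)"
proof -
  have "((\<lambda>s. wmean k f x (sqrt s)) has_real_derivative 
      (sqrt s / (2 * real (Suc k)) * wmean (Suc k) (laplacian f) x (sqrt s)) * (inverse (sqrt s) / 2)) (at s)"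
    by (rule DERIV_chain2[OF DERIV_wmean[OF k f] DERIV_real_sqrt[OF s]])
  moreover have "(sqrt s / (2 * real (Suc k)) * wmean (Suc k) (laplacian f) x (sqrt s)) * (inverse (sqrt s) / 2) =
      wmean (Suc k) (laplacian f) x (sqrt s) / (4 * real (Suc k))"
    using s by (simp add: field_simps del: of_nat_Suc)
  ultimately show ?thesis by (simp only:)
qed

text \<open>Dominated convergence: the weights lie between 0 and 1 and tend pointwise to
  \<open>psi k 0 = 1\<close>.\<close>

lemma psi_scaled_integral_tendsto:
  fixes F :: "'a::euclidean_space \<Rightarrow> real"
  assumes F: "integrable lborel F"
  shows "((\<lambda>s. LINT z|lborel. psi k ((1 / sqrt s) *\<^sub>R z) * F z) \<longlongrightarrow> (LINT z|lborel. F z)) at_top"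
proof (rule integral_dominated_convergence_at_top[where w="\<lambda>z. norm (F z)"])
  note [measurable] = borel_measurable_integrable[OF F]
  have [measurable]: "psi k \<in> borel_measurable (borel :: 'a measure)"
    by (intro borel_measurable_continuous_onI continuous_on_psi)
  show "(\<lambda>z. psi k ((1 / sqrt s) *\<^sub>R z) * F z) \<in> borel_measurable lborel" for s by measurable
  show "AE z in lborel. ((\<lambda>s. psi k ((1 / sqrt s) *\<^sub>R z) * F z) \<longlongrightarrow> F z) at_top"
  proof (rule AE_I2)
    fix z :: 'a
    have "((\<lambda>s. 1 / sqrt s) \<longlongrightarrow> 0) at_top"
      by (rule tendsto_divide_0[OF tendsto_const filterlim_at_top_imp_at_infinity[OF sqrt_at_top]])
    then have "((\<lambda>s. (1 / sqrt s) *\<^sub>R z) \<longlongrightarrow> 0 *\<^sub>R z) at_top"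
      by (intro tendsto_scaleR tendsto_const)
    moreover have "isCont (psi k) (0::'a)"
      using continuous_on_psi[of "UNIV :: 'a set" k] by (simp add: continuous_on_eq_continuous_at)
    ultimately have "((\<lambda>s. psi k ((1 / sqrt s) *\<^sub>R z)) \<longlongrightarrow> psi k (0::'a)) at_top"
      by (intro isCont_tendsto_compose[of 0 "psi k"]) auto
    from tendsto_mult_right[OF this, of "F z"]
    show "((\<lambda>s. psi k ((1 / sqrt s) *\<^sub>R z) * F z) \<longlongrightarrow> F z) at_top" by (simp add: psi_def)
  qed
  show "\<forall>\<^sub>F s in at_top. AE z in lborel. norm (psi k ((1 / sqrt s) *\<^sub>R z) * F z) \<le> norm (F z)"
    by (intro always_eventually allI AE_I2) (simp add: abs_mult mult_left_le_one_le)
qed (use F in auto)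

lemma neg_laplacian_pow_Suc: "neg_laplacian_pow (Suc j) u x = - laplacian (neg_laplacian_pow j u) x"
  by (simp add: neg_laplacian_pow_def)

text \<open>Up to a positive factor, \<open>j\<close> derivatives of \<open>s \<mapsto> wmean 1 u 0 (\<surd>s)\<close> give a mean of \<open>\<Delta>\<^sup>j u\<close>; after
  \<open>m\<close> of them the change of variables shows the leading term \<open>s\<^bsup>-m\<^esup> \<integral>(-\<Delta>)\<^sup>m u\<close>, which is compared
  with the \<open>m\<close>-th derivative of \<open>- B ln s\<close>.\<close>

lemma wmean_log_lower_bound:
  fixes u :: "'a::euclidean_space \<Rightarrow> real"
  assumes dim: "DIM('a) = 2 * m" and m: "m \<ge> 1" and u: "smooth u"
    and int: "integrable lborel (neg_laplacian_pow m u)"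
    and B: "(LINT x|lborel. neg_laplacian_pow m u x) / (4 ^ m * fact (m + 1) * fact (m - 1)) < B"
    and low: "\<And>x. norm x \<ge> R \<Longrightarrow> u x \<ge> - 2 * ln (norm x) - C"
  shows "\<exists>C. \<forall>\<^sub>F s in at_top. wmean 1 u 0 (sqrt s) \<ge> - B * ln s - C"
proof -
  define V where "V = (LINT y::'a|lborel. psi 1 y)"
  have V: "V > 0" using integral_psi_1[OF dim] by (simp add: V_def)
  define I where "I = (LINT x|lborel. neg_laplacian_pow m u x)"
  define N where "N j s = wmean (Suc j) (neg_laplacian_pow j u) 0 (sqrt s)" for j s
  \<comment> \<open>\<open>L j\<close> is (-1)^j times the j-th derivative of B ln s, and
    \<open>Y j\<close> is the same for the sum of the mean and B ln s. Differentiating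
    \<open>N j\<close> costs a factor 1 / (4 (j + 2)), whence the product 4^j (j + 1)!.\<close>
  define L where "L j s = (if j = 0 then B * ln s else - B * fact (j - 1) / s ^ j)" for j and s :: real
  define Y where "Y j s = N j s / (4 ^ j * fact (Suc j)) + L j s" for j s
  have Ck: "Ck k (neg_laplacian_pow j u)" for k j
    using smooth_neg_laplacian_pow[OF u] by (simp add: smooth_def)
  have dN: "(N j has_real_derivative - N (Suc j) s / (4 * real (Suc (Suc j)))) (at s)" if "s > 0" for j s
    using DERIV_wmean_sqrt[OF _ Ck that, of "Suc j" j 0]
    by (simp add: N_def[abs_def] wmean_def neg_laplacian_pow_Suc)
  have dL: "(L j has_real_derivative - L (Suc j) s) (at s)" if s: "s > 0" for j s
  proof (cases j)
    case 0
    then show ?thesis using s by (auto simp: L_def[abs_def] intro!: derivative_eq_intros)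
  next
    case (Suc i)
    have "((\<lambda>s. inverse (s ^ Suc i)) has_real_derivative - (inverse (s ^ Suc i) * (real (Suc i) * s ^ i) * inverse (s ^ Suc i))) (at s)"
      using s DERIV_pow[of "Suc i" s] by (intro DERIV_inverse') auto
    then have "((\<lambda>s. (- B * fact i) * inverse (s ^ Suc i)) has_real_derivative
      (- B * fact i) * - (inverse (s ^ Suc i) * (real (Suc i) * s ^ i) * inverse (s ^ Suc i))) (at s)"
      by (rule DERIV_cmult)
    moreover have "(- B * fact i) * - (inverse (s ^ Suc i) * (real (Suc i) * s ^ i) * inverse (s ^ Suc i)) = - L (Suc j) s"
      using s Suc by (simp add: L_def field_simps)
    moreover have "L j = (\<lambda>s. (- B * fact i) * inverse (s ^ Suc i))"
      using Suc by (simp add: L_def[abs_def] divide_inverse)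
    ultimately show ?thesis by (simp only:)
  qed
  have dY: "(Y j has_real_derivative - Y (Suc j) s) (at s)" if "s > 0" for j s
  proof -
    have "(Y j has_real_derivative - N (Suc j) s / (4 * real (Suc (Suc j))) / (4 ^ j * fact (Suc j)) + - L (Suc j) s) (at s)"
      unfolding Y_def[abs_def] by (intro DERIV_add DERIV_cdivide dN dL that)
    then show ?thesis by (simp add: Y_def field_simps)
  qed
  \<comment> \<open>In dimension 2 m, s^m times \<open>N m s\<close> is an integral tending to
    \<open>I\<close>. By the strict bound on \<open>B\<close>, the negative term \<open>L m\<close>
    eventually outweighs it.\<close>
  have "\<forall>\<^sub>F s in at_top. Y m s \<le> 0"
  proof -
    have "I < B * (4 ^ m * fact (m + 1) * fact (m - 1))"
      using B by (simp add: I_def divide_less_eq)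
    then have "\<forall>\<^sub>F s in at_top. (LINT z|lborel. psi (Suc m) ((1 / sqrt s) *\<^sub>R z) * neg_laplacian_pow m u z)
        < B * (4 ^ m * fact (m + 1) * fact (m - 1))"
      using order_tendstoD(2)[OF psi_scaled_integral_tendsto[OF int]] by (simp add: I_def)
    then show ?thesis
      using eventually_gt_at_top[of 0]
    proof eventually_elim
      case (elim s)
      have "s ^ m * N m s = (LINT z|lborel. psi (Suc m) ((1 / sqrt s) *\<^sub>R z) * neg_laplacian_pow m u z)"
        using integral_psi_scaled[OF Ck_imp_continuous_on[OF Ck], of "sqrt s" "Suc m" 0] elim
        by (simp add: N_def dim power_mult)
      then have "s ^ m * N m s < B * (4 ^ m * fact (m + 1) * fact (m - 1))" using elim by simp
      moreover define q where "q = (4 ^ m * fact (Suc m) :: real)"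
      ultimately have "N m s * s ^ m < B * fact (m - 1) * q"
        by (simp only: Suc_eq_plus1 mult_ac)
      moreover have "q > 0" "s ^ m > 0" using elim by (simp_all add: q_def)
      ultimately have "N m s / q < B * fact (m - 1) / s ^ m"
        by (simp add: pos_divide_less_eq pos_less_divide_eq)
      then have "N m s / (4 ^ m * fact (Suc m)) < B * fact (m - 1) / s ^ m"
        by (simp only: q_def)
      then show ?case using m by (simp add: Y_def L_def)
    qed
  qed
  \<comment> \<open>The lower bound on \<open>u\<close> makes the mean at least - V ln s minus a
    constant, so \<open>Y 0 s\<close> is at least (B - V) ln s minus a constant, and ln s =
    o(s).\<close>
  moreover have "\<forall>\<^sub>F s in at_top. Y 0 s \<ge> - c * s" if c: "c > 0" for c
  proof -
    have "continuous_on (cball 0 (max R 1)) u" using Ck[of 0 0] by (intro Ck_imp_continuous_on[of 0]) (simp add: neg_laplacian_pow_def)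
    then have "bounded (u ` cball 0 (max R 1))"
      by (intro compact_imp_bounded compact_continuous_image) auto
    then obtain M where M: "\<And>x. norm x \<le> max R 1 \<Longrightarrow> \<bar>u x\<bar> \<le> M"
      unfolding bounded_iff by (metis image_eqI mem_cball_0 real_norm_def)
    define C' where "C' = max C M"
    have "((\<lambda>s. (B - V) * (ln s / s) - C' * V * (1 / s)) \<longlongrightarrow> (B - V) * 0 - C' * V * 0) at_top"
      by (intro tendsto_intros ln_x_over_x_tendsto_0 tendsto_divide_0[OF tendsto_const]
           filterlim_at_top_imp_at_infinity filterlim_ident)
    then have "\<forall>\<^sub>F s in at_top. (B - V) * (ln s / s) - C' * V * (1 / s) > - c"
      by (rule order_tendstoD) (use c in simp)
    then show ?thesis
      using eventually_ge_at_top[of "max 1 (R\<^sup>2)"]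
    proof eventually_elim
      case (elim s)
      have s: "s \<ge> 1" using elim by simp
      \<comment> \<open>The weight vanishes off the open unit ball, so only points of norm below
        sqrt s count and - 2 ln of their norm exceeds - ln s. Near the origin the bound
        \<open>M\<close> and ln s \<ge> 0 are used instead.\<close>
      have pt: "u (0 + sqrt s *\<^sub>R y) \<ge> - ln s - C'" if y: "psi 1 y \<noteq> 0" for y :: 'a
      proof (cases "norm (sqrt s *\<^sub>R y) \<le> max R 1")
        case True
        then show ?thesis using M[OF True] ln_ge_zero[OF s] by (auto simp: C'_def)
      next
        case False
        then have "norm y > 0" "s > 0" using s by auto
        have "norm y < 1" using y psi_eq_0[of 1 y] by force
        then have "norm (sqrt s *\<^sub>R y) \<le> sqrt s" using s by (simp add: mult_left_le)
        then have "ln (norm (sqrt s *\<^sub>R y)) \<le> ln (sqrt s)"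
          using s \<open>norm y > 0\<close> by (intro ln_mono) auto
        also have "ln (sqrt s) = ln s / 2" using s by (simp add: ln_sqrt)
        finally have "- ln s \<le> - 2 * ln (norm (sqrt s *\<^sub>R y))" by linarith
        moreover have "- 2 * ln (norm (sqrt s *\<^sub>R y)) - C \<le> u (sqrt s *\<^sub>R y)"
          using False by (intro low) linarith
        moreover have "C \<le> C'" by (simp add: C'_def)
        ultimately show ?thesis unfolding add_0_left by linarith
      qed
      have "wmean 1 (\<lambda>x. - ln s - C') (0::'a) (sqrt s) \<le> wmean 1 u 0 (sqrt s)"
        by (intro wmean_mono pt Ck_imp_continuous_on[of 0 u]) (use u in \<open>auto simp: smooth_def simp del: Ck.simps\<close>)
      then have "V * (- ln s - C') \<le> N 0 s" by (simp add: N_def wmean_def V_def neg_laplacian_pow_def)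
      then have "(B - V) * ln s - C' * V \<le> Y 0 s" by (simp add: Y_def L_def algebra_simps)
      moreover have "(B - V) * ln s - C' * V = ((B - V) * (ln s / s) - C' * V * (1 / s)) * s"
        using s by (simp add: field_simps)
      moreover have "\<dots> \<ge> - c * s" using elim s by (intro mult_right_mono) auto
      ultimately show ?case by linarith
    qed
  qed
  ultimately obtain D where "\<forall>\<^sub>F s in at_top. Y 0 s \<ge> D"
    using iterated_derivative_bounded_below[of m 0 Y] dY m by blast
  then have "\<forall>\<^sub>F s in at_top. wmean 1 u 0 (sqrt s) \<ge> - B * ln s - (- D)"
    by eventually_elim (simp add: Y_def N_def L_def neg_laplacian_pow_def)
  then show ?thesis by blast
qed

subsection \<open>Completeness\<close>

lemma conf_dist_le_linepath:
  fixes u :: "'a::euclidean_space \<Rightarrow> real"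
  assumes M: "\<And>z. z \<in> cball x 1 \<Longrightarrow> u z \<le> M" and y: "y \<in> cball x 1"
  shows "conf_dist u x y \<le> exp M * dist x y"
proof -
  let ?l = "linepath x y"
  have "closed_segment x y \<subseteq> cball x 1" using y by (intro closed_segment_subset) auto
  then have l: "u (?l t) \<le> M" if "t \<in> {0..1}" for t
    using M linepath_in_path[OF that, of x y] by blast
  have "conf_length u ?l \<le> (\<integral>\<^sup>+t\<in>{0..1}. ennreal (exp M * dist x y) \<partial>(lborel::real measure))"
    unfolding conf_length_def
    by (intro nn_integral_mono)
      (use l in \<open>auto simp: indicator_def dist_norm norm_minus_commute intro!: ennreal_leI mult_right_mono\<close>)
  also have "\<dots> = ennreal (exp M * dist x y)" by (simp add: nn_integral_cmult_indicator)
  finally have "(INF g\<in>{g. valid_path g \<and> pathstart g = x \<and> pathfinish g = y}. conf_length u g) \<le> ennreal (exp M * dist x y)"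
    by (intro INF_lower2[of ?l]) auto
  from enn2real_mono[OF this] show ?thesis by (simp add: conf_dist_def)
qed

lemma conf_dist_ge:
  fixes u :: "'a::euclidean_space \<Rightarrow> real"
  assumes u: "continuous_on UNIV u" and M: "\<And>z. z \<in> cball x r \<Longrightarrow> M \<le> u z" and r: "0 < r" "r \<le> dist x y"
  shows "exp M * r \<le> conf_dist u x y"
proof -
  let ?I = "INF g\<in>{g. valid_path g \<and> pathstart g = x \<and> pathfinish g = y}. conf_length u g"
  have "ennreal (exp M * r) \<le> ?I"
    by (rule INF_greatest) (use conf_length_lower[OF u _ _ _ M r] in auto)
  \<comment> \<open>\<open>enn2real\<close> maps infinity to 0, so its monotonicity requires a
    finite infimum; the segment provides it.\<close>
  moreover have "?I \<le> conf_length u (linepath x y)" by (rule INF_lower) auto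
  then have "?I < top" using conf_length_linepath[OF u, of x y] by (simp add: order_le_less_trans)
  ultimately have "enn2real (ennreal (exp M * r)) \<le> enn2real ?I" by (intro enn2real_mono)
  then show ?thesis using r by (simp add: conf_dist_def)
qed

text \<open>As in the Hopf-Rinow theorem: a Cauchy sequence is bounded, so a subsequence converges
  in the Euclidean sense. Near its limit \<open>conf_dist\<close> is at most a multiple of the
  Euclidean distance, so the subsequence, and with it the Cauchy sequence, converges for
  \<open>conf_dist\<close>.\<close>

lemma complete_if_bounded_sets_bounded:
  fixes u :: "'a::euclidean_space \<Rightarrow> real"
  assumes u: "continuous_on UNIV u" and bdd: "\<And>D. bounded {x. conf_dist u 0 x \<le> D}"
  shows "complete_conf_metric u"
proof -
  interpret M: Metric_space UNIV "conf_dist u" using u by (rule Metric_space_conf_dist)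
  show ?thesis
    unfolding complete_conf_metric_def M.mcomplete_def
  proof (intro allI impI)
    fix \<sigma> assume cauchy: "M.MCauchy \<sigma>"
    then have "M.mbounded (range \<sigma>)" by (rule M.MCauchy_imp_mbounded)
    then obtain c B where "range \<sigma> \<subseteq> M.mcball c B" by (auto simp: M.mbounded_def)
    then have B: "conf_dist u c (\<sigma> n) \<le> B" for n
      using rangeI[of \<sigma> n] by (auto simp: M.mcball_def)
    have "conf_dist u 0 (\<sigma> n) \<le> conf_dist u 0 c + B" for n
    proof -
      have "conf_dist u 0 (\<sigma> n) \<le> conf_dist u 0 c + conf_dist u c (\<sigma> n)" by (rule M.triangle) simp_all
      with B[of n] show ?thesis by linarith
    qed
    then have "bounded (range \<sigma>)" by (intro bounded_subset[OF bdd]) auto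
    then obtain l r where lr: "strict_mono (r :: nat \<Rightarrow> nat)" "(\<sigma> \<circ> r) \<longlonglongrightarrow> l"
      using bounded_imp_convergent_subsequence by blast
    have "bounded (u ` cball l 1)"
      by (intro compact_imp_bounded compact_continuous_image continuous_on_subset[OF u]) auto
    then obtain K where K: "\<And>z. z \<in> cball l 1 \<Longrightarrow> u z \<le> K"
      unfolding bounded_iff by (metis abs_le_D1 image_eqI real_norm_def)
    have d0: "(\<lambda>n. dist l ((\<sigma> \<circ> r) n)) \<longlonglongrightarrow> 0"
      using tendsto_dist[OF tendsto_const lr(2), of l] by simp
    have "(\<lambda>n. conf_dist u l ((\<sigma> \<circ> r) n)) \<longlonglongrightarrow> 0"
    proof (rule Lim_null_comparison)
      show "\<forall>\<^sub>F n in sequentially. norm (conf_dist u l ((\<sigma> \<circ> r) n)) \<le> exp K * dist l ((\<sigma> \<circ> r) n)"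
        using order_tendstoD(2)[OF d0, of 1]
        by (auto elim!: eventually_mono intro!: conf_dist_le_linepath[OF K])
      show "(\<lambda>n. exp K * dist l ((\<sigma> \<circ> r) n)) \<longlonglongrightarrow> 0"
        using tendsto_mult_right_zero[OF d0] .
    qed
    then have "limitin M.mtopology (\<sigma> \<circ> r) l sequentially"
      by (simp add: M.limitin_metric_dist_null M.commute)
    from M.MCauchy_convergent_subsequence[OF cauchy lr(1) this]
    show "\<exists>x. limitin M.mtopology \<sigma> x sequentially" by blast
  qed
qed

text \<open>On the ball of radius \<open>|y|\<close> the conformal factor is at least \<open>c |y|\<^bsup>-b\<^esup>\<close>, so the distance from the
  origin to \<open>y\<close> is at least \<open>c |y|\<^bsup>1-b\<^esup>\<close>.\<close>

lemma complete_if_log_lower_bound: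
  fixes u :: "'a::euclidean_space \<Rightarrow> real"
  assumes u: "continuous_on UNIV u" and b: "0 \<le> b" "b < 1"
    and low: "\<And>x. norm x \<ge> R \<Longrightarrow> u x \<ge> - b * ln (norm x) - C"
  shows "complete_conf_metric u"
proof (rule complete_if_bounded_sets_bounded[OF u])
  fix D
  define R' where "R' = max R 1"
  have "bounded (u ` cball 0 R')"
    by (intro compact_imp_bounded compact_continuous_image continuous_on_subset[OF u]) auto
  then obtain M where M: "\<And>x. norm x \<le> R' \<Longrightarrow> \<bar>u x\<bar> \<le> M"
    unfolding bounded_iff by (metis image_eqI mem_cball_0 real_norm_def)
  define K where "K = max C M"
  have dist: "exp (- K) * exp ((1 - b) * ln (norm y)) \<le> conf_dist u 0 y" if y: "norm y \<ge> R'" for y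
  proof -
    have y1: "norm y \<ge> 1" "norm y > 0" using y by (auto simp: R'_def)
    have "exp (- b * ln (norm y) - K) * norm y \<le> conf_dist u 0 y"
    proof (rule conf_dist_ge[OF u])
      fix z :: 'a assume "z \<in> cball 0 (norm y)"
      then have z: "norm z \<le> norm y" by simp
      show "- b * ln (norm y) - K \<le> u z"
      proof (cases "norm z \<le> R'")
        case True
        have "b * ln (norm y) \<ge> 0" using b y1 by simp
        then show ?thesis using M[OF True] by (simp add: K_def)
      next
        case False
        then have z1: "norm z \<ge> R" "norm z > 0" by (auto simp: R'_def)
        have "ln (norm z) \<le> ln (norm y)" using z z1 by (intro ln_mono) auto
        then have "b * ln (norm z) \<le> b * ln (norm y)" using b by (intro mult_left_mono)
        then show ?thesis using low[OF z1(1)] by (simp add: K_def)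
      qed
    qed (use y1 in auto)
    also have "exp (- b * ln (norm y) - K) * norm y = exp (- b * ln (norm y) - K) * exp (ln (norm y))"
      using y1 by simp
    also have "\<dots> = exp (- K) * exp ((1 - b) * ln (norm y))"
      by (simp add: algebra_simps flip: exp_add)
    finally show ?thesis .
  qed
  have "filterlim (\<lambda>t. exp (- K) * exp ((1 - b) * ln t)) at_top at_top"
    using b by (intro filterlim_tendsto_pos_mult_at_top[OF tendsto_const] ln_at_top
        filterlim_compose[OF exp_at_top]) auto
  then have "\<forall>\<^sub>F t in at_top. D < exp (- K) * exp ((1 - b) * ln t)"
    by (simp add: filterlim_at_top_dense)
  then obtain T where T: "\<And>t. t \<ge> T \<Longrightarrow> D < exp (- K) * exp ((1 - b) * ln t)"
    by (auto simp: eventually_at_top_linorder)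
  have "norm y \<le> max T R'" if "conf_dist u 0 y \<le> D" for y
  proof (rule ccontr)
    assume "\<not> norm y \<le> max T R'"
    then have "norm y \<ge> T" "norm y \<ge> R'" by auto
    then show False using dist[of y] T[of "norm y"] that by linarith
  qed
  then show "bounded {x. conf_dist u 0 x \<le> D}" unfolding bounded_iff by blast
qed

text \<open>With n = 2 m, the threshold (n - 1)! |S^n| / 2 divided by the constant 4^m (m + 1)! (m -
  1)! of \<open>wmean_log_lower_bound\<close> is therefore pi^m / (2 (m + 1)!), half the mass of
  \<open>psi 1\<close>.\<close>

lemma unit_sphere_vol_even:
  assumes "m \<ge> 1"
  shows "fact (2 * m - 1) * unit_sphere_vol (2 * m) = 4 ^ m * pi ^ m * fact (m - 1)"
proof -
  obtain k where k: "m = Suc k" using assms by (cases m) auto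
  have "unit_sphere_vol (2 * m) = real (2 * m + 1) * (2 ^ (2 * Suc m) * fact (Suc m) / fact (2 * Suc m) * pi ^ m)"
    unfolding unit_sphere_vol_def by (simp only: unit_ball_vol_odd)
  moreover have "fact (2 * Suc m) = 4 * (real (k + 2) * real (k + 1)) * real (2 * k + 3) * fact (2 * k + 1)"
    by (simp add: k algebra_simps)
  moreover have "fact (Suc m) = real (k + 2) * real (k + 1) * fact k"
    by (simp add: k algebra_simps)
  moreover have "real (2 * m + 1) = real (2 * k + 3)" "2 * m - 1 = 2 * k + 1" "m - 1 = k"
    by (simp_all add: k)
  moreover have "2 ^ (2 * Suc m) = (4 * 4 ^ m :: real)" by (simp add: power_mult)
  moreover have "F * (b * (4 * X * (a * G) / (4 * a * b * F) * P)) = X * P * G"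
    if "F \<noteq> 0" "a \<noteq> 0" "b \<noteq> 0" for F a b G P X :: real
    using that by (simp add: field_simps)
  ultimately show ?thesis
    by (simp only:) (simp del: of_nat_add of_nat_mult fact_Suc)
qed

theorem corollary1p5:
  fixes u Q :: "real ^ 'n \<Rightarrow> real"
  assumes "CARD('n) \<ge> 4" and "even CARD('n)"
    and "smooth u"
    and "is_Q_curvature u Q"
    and "integrable lborel (\<lambda>x. Q x * exp (real CARD('n) * u x))"
    and "\<exists>K. compact K \<and> (\<forall>x. x \<notin> K \<longrightarrow> scalar_curvature u x \<ge> 0)"
    and "(LINT x|lborel. Q x * exp (real CARD('n) * u x))
           < fact (CARD('n) - 1) * unit_sphere_vol CARD('n) / 2"
  shows "complete_conf_metric u"
proof -
  obtain m where m: "CARD('n) = 2 * m" using assms(2) by blast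
  define p where "p = m - 1"
  have dim: "DIM(real ^ 'n) = 2 * m" and dim': "DIM(real ^ 'n) = 2 * p + 2" and p: "p \<ge> 1" "m \<ge> 1"
    using m assms(1) by (auto simp: p_def)
  have Ck: "Ck k u" for k using assms(3) by (simp add: smooth_def)
  have u: "continuous_on UNIV u" using Ck_imp_continuous_on[OF Ck] .
  have F: "neg_laplacian_pow m u = (\<lambda>x. Q x * exp (real CARD('n) * u x))"
    using assms(4) m by (auto simp: is_Q_curvature_def fun_eq_iff)
  define I where "I = (LINT x|lborel. neg_laplacian_pow m u x)"
  define V where "V = (LINT y::real^'n|lborel. psi 1 y)"
  have V: "V = pi ^ m / fact (m + 1)" "V > 0"
    unfolding V_def using integral_psi_1[OF dim] by simp_all
  have "I < 4 ^ m * pi ^ m * fact (m - 1) / 2"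
    using assms(7) unit_sphere_vol_even[OF p(2)] by (simp add: I_def F m)
  moreover have "I / (q * f * g) < P / f / 2" if "I < q * P * g / 2" "q > 0" "f > 0" "g > 0" for q P f g :: real
  proof -
    have "I / (q * f * g) < (q * P * g / 2) / (q * f * g)"
      using that by (intro divide_strict_right_mono) auto
    also have "\<dots> = P / f / 2" using that by simp
    finally show ?thesis .
  qed
  ultimately have "I / (4 ^ m * fact (m + 1) * fact (m - 1)) < V / 2"
    unfolding V by simp
  \<comment> \<open>The total Q-curvature may be negative; the maximum with 0 keeps the exponent
    \<open>2 * B / V\<close> below nonnegative, and \<open>B < V / 2\<close> makes it less than
    1.\<close>
  then have "max 0 (I / (4 ^ m * fact (m + 1) * fact (m - 1))) < V / 2" using V by simp
  then obtain B where B: "max 0 (I / (4 ^ m * fact (m + 1) * fact (m - 1))) < B" "B < V / 2"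
    using dense by blast
  obtain K where K: "compact K" "\<And>x. x \<notin> K \<Longrightarrow> scalar_curvature u x \<ge> 0"
    using assms(6) by blast
  obtain R0 where R0: "\<And>x. x \<in> K \<Longrightarrow> norm x \<le> R0"
    using compact_imp_bounded[OF K(1)] by (auto simp: bounded_iff)
  define R where "R = max 2 (R0 + 1)"
  have R: "R > 1" by (simp add: R_def)
  have super: "laplacian (\<lambda>x. exp (real p * u x)) x \<le> 0" if "norm x \<ge> R" for x
  proof (rule laplacian_exp_nonpos[OF dim' Ck K(2)])
    show "x \<notin> K" using R0[of x] that by (auto simp: R_def)
  qed
  obtain C1 where C1: "\<And>x. norm x \<ge> R \<Longrightarrow> u x \<ge> - 2 * ln (norm x) - C1"
    using superharmonic_exp_log_lower_bound[OF dim' p(1) Ck R super] by blast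
  obtain C2 where C2: "\<And>x. norm x \<ge> R \<Longrightarrow> u x \<ge> wmean 1 u 0 (norm x) / V - C2"
    using superharmonic_exp_mean_lower_bound[OF dim' p(1) Ck R super] by (auto simp: V_def)
  obtain C3 where "\<forall>\<^sub>F s in at_top. wmean 1 u 0 (sqrt s) \<ge> - B * ln s - C3"
    using wmean_log_lower_bound[OF dim p(2) assms(3) _ _ C1, of B] assms(5) B(1) by (auto simp: F I_def)
  then obtain S where S: "\<And>s. s \<ge> S \<Longrightarrow> wmean 1 u 0 (sqrt s) \<ge> - B * ln s - C3"
    by (auto simp: eventually_at_top_linorder)
  show ?thesis
  \<comment> \<open>For s = |x|^2, - B ln s = - 2 B ln |x|, and division by the mass
    \<open>V\<close> gives the exponent. Since |x| > 1, |x| \<ge> S implies s \<ge> S.\<close>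
  proof (rule complete_if_log_lower_bound[OF u, of "2 * B / V" "max R S" "C3 / V + C2"])
    show "0 \<le> 2 * B / V" "2 * B / V < 1" using B V(2) by auto
    fix x :: "real ^ 'n" assume x: "norm x \<ge> max R S"
    have "norm x * 1 \<le> norm x * norm x" using x R by (intro mult_left_mono) auto
    then have "(norm x)\<^sup>2 \<ge> S" using x by (simp add: power2_eq_square)
    from S[OF this] have "- B * (2 * ln (norm x)) - C3 \<le> wmean 1 u 0 (norm x)"
      using x R by (simp add: ln_realpow)
    then have "(- B * (2 * ln (norm x)) - C3) / V \<le> wmean 1 u 0 (norm x) / V"
      using V(2) by (intro divide_right_mono) auto
    then show "- (2 * B / V) * ln (norm x) - (C3 / V + C2) \<le> u x"
      using C2[of x] x by (simp add: diff_divide_distrib mult_ac)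
  qed
qed

end
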